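(* Let $X$ be a complex Hilbert space, let $M_1,M_2$ be closed subspaces of $X$, let $P_1,P_2$ be the orthogonal projections onto $M_1,M_2$ respectively, and let $$T=P_2P_1+(I-P_2)(I-P_1)$$ be the corresponding Douglas-Rachford operator. Let $P$ denote the orthogonal projection onto $(M_1\cap M_2)\oplus(M_1^\perp\cap M_2^\perp)$. Then for all $x\in X$ we have $$\|T^nx-Px\|\to0,\quad n\to\infty.\qquad( * )$$ Moreover: (i) if $M_1+M_2$ is closed, then there exist $C>0$ and $r\in[0,1)$ such that $\|T^n-P\|\le Cr^n$ for all $n\ge0$; (ii) if $M_1+M_2$ is not closed, then the convergence in $( * )$ is arbitrarily slow and weakly arbitrarily slow; (iii) in either case there exists a dense subspace $X_0$ of $X$ such that for all $x\in X_0$ the convergence in $( * )$ is superpolynomially fast.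
   Context: Let $T_n$, $n\ge0$, be bounded linear operators on $X$ satisfying $\|T_nx\|\to0$ as $n\to\infty$ for all $x\in X$. The convergence is *arbitrarily slow* if for every sequence $(r_n)_{n\ge0}$ of non-negative scalars with $r_n\to0$ there exists $x\in X$ such that $\|T_nx\|\ge r_n$ for all $n\ge0$. It is *weakly arbitrarily slow* if for every such sequence $(r_n)_{n\ge0}$ there exist $x\in X$ and $\phi\in X^*$ such that $\operatorname{Re}\langle T_nx,\phi\rangle\ge r_n$ for all $n\ge0$, where $\langle x,\phi\rangle=\phi(x)$. It is *superpolynomially fast* for a particular $x\in X$ if $\|T_nx\|=o(n^{-k})$ as $n\to\infty$ for all $k\ge1$. For the convergence in $( * )$ these notions are applied with $T_n=T^n-P$. *)

theory Defs
  imports "HOL-Analysis.Analysis" "HOL-Library.Set_Algebras" "HOL-Library.Landau_Symbols"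
begin

class complex_vector = real_vector +
  fixes scaleC :: "complex \<Rightarrow> 'a \<Rightarrow> 'a" (infixr "*\<^sub>C" 75)
  assumes scaleC_add_right: "c *\<^sub>C (x + y) = c *\<^sub>C x + c *\<^sub>C y"
    and scaleC_add_left: "(c + d) *\<^sub>C x = c *\<^sub>C x + d *\<^sub>C x"
    and scaleC_scaleC: "c *\<^sub>C (d *\<^sub>C x) = (c * d) *\<^sub>C x"
    and scaleC_one: "1 *\<^sub>C x = x"
    and scaleR_eq_scaleC: "r *\<^sub>R x = complex_of_real r *\<^sub>C x"

text \<open>
  The complex inner product is linear in its first argument.  The underlying real inner product
  space (class \<^class>\<open>real_inner\<close>) carries the real part of the complex inner product;
  hence positive definiteness and \<open>norm x = sqrt (Re (cinner x x))\<close> are inherited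
  from \<^class>\<open>real_inner\<close>.
\<close>

class complex_inner = complex_vector + real_inner +
  fixes cinner :: "'a \<Rightarrow> 'a \<Rightarrow> complex"
  assumes cinner_commute: "cinner x y = cnj (cinner y x)"
    and cinner_add_left: "cinner (x + y) z = cinner x z + cinner y z"
    and cinner_scaleC_left: "cinner (c *\<^sub>C x) y = c * cinner x y"
    and inner_eq_Re_cinner: "inner x y = Re (cinner x y)"

class complex_hilbert = complex_inner + complete_space

definition csubspace :: "'a::complex_vector set \<Rightarrow> bool" where
  "csubspace M \<longleftrightarrow>
     0 \<in> M \<and> (\<forall>x\<in>M. \<forall>y\<in>M. x + y \<in> M) \<and> (\<forall>c. \<forall>x\<in>M. c *\<^sub>C x \<in> M)"

definition ocomp :: "'a::complex_inner set \<Rightarrow> 'a set" where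
  "ocomp M = {x. \<forall>y\<in>M. cinner x y = 0}"

text \<open>
  The orthogonal projection; meaningful for closed subspaces of a Hilbert space, for which
  the described vector exists and is unique.
\<close>

definition oproj :: "'a::complex_inner set \<Rightarrow> 'a \<Rightarrow> 'a" where
  "oproj M x = (THE y. y \<in> M \<and> x - y \<in> ocomp M)"

definition douglas_rachford :: "'a::complex_inner set \<Rightarrow> 'a set \<Rightarrow> 'a \<Rightarrow> 'a" where
  "douglas_rachford M1 M2 x =
     oproj M2 (oproj M1 x) + ((x - oproj M1 x) - oproj M2 (x - oproj M1 x))"

definition cdual :: "('a::complex_inner \<Rightarrow> complex) set" where
  "cdual = {\<phi>. bounded_linear \<phi> \<and> (\<forall>c x. \<phi> (c *\<^sub>C x) = c * \<phi> x)}"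

text \<open>
  The following three notions are meant for sequences of bounded linear operators that converge
  strongly to zero.
\<close>

definition arbitrarily_slow :: "(nat \<Rightarrow> 'a \<Rightarrow> 'a::complex_inner) \<Rightarrow> bool" where
  "arbitrarily_slow S \<longleftrightarrow>
     (\<forall>r :: nat \<Rightarrow> real. (\<forall>n. 0 \<le> r n) \<and> r \<longlonglongrightarrow> 0 \<longrightarrow> (\<exists>x. \<forall>n. r n \<le> norm (S n x)))"

definition weakly_arbitrarily_slow :: "(nat \<Rightarrow> 'a \<Rightarrow> 'a::complex_inner) \<Rightarrow> bool" where
  "weakly_arbitrarily_slow S \<longleftrightarrow>
     (\<forall>r :: nat \<Rightarrow> real. (\<forall>n. 0 \<le> r n) \<and> r \<longlonglongrightarrow> 0 \<longrightarrow>
        (\<exists>x. \<exists>\<phi>\<in>cdual. \<forall>n. r n \<le> Re (\<phi> (S n x))))"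

definition superpolynomially_fast :: "(nat \<Rightarrow> 'a \<Rightarrow> 'a::complex_inner) \<Rightarrow> 'a \<Rightarrow> bool" where
  "superpolynomially_fast S x \<longleftrightarrow>
     (\<forall>k::nat. 1 \<le> k \<longrightarrow> (\<lambda>n. norm (S n x)) \<in> o(\<lambda>n. 1 / real n ^ k))"

end

theory Submission
  imports Defs
begin

text \<open>
  Since \<open>T = (I + U) / 2\<close> with \<open>U = (2 P\<^sub>2 - I) (2 P\<^sub>1 - I)\<close> isometric,
  \<open>\<parallel>T x\<parallel>\<^sup>2 + \<parallel>x - T x\<parallel>\<^sup>2 = \<parallel>x\<parallel>\<^sup>2\<close>, and this identity replaces the spectral theorem
  throughout. Telescoping it gives \<open>\<parallel>T\<^sup>n (x - T x)\<parallel> \<le> \<parallel>x\<parallel> / sqrt (n + 1)\<close>, hence strong convergence,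
  since the range of \<open>I - T\<close> is dense in the orthogonal complement \<open>G\<close> of the fixed space.
  Iterating \<open>x \<mapsto> x - T\<^sup>m x\<close> with rapidly increasing \<open>m\<close> approximates each vector
  of \<open>G\<close> by vectors whose orbits decay superpolynomially.

  Moreover \<open>\<parallel>x - T x\<parallel> = \<parallel>P\<^sub>1 x - P\<^sub>2 x\<parallel>\<close>, and by the open mapping argument
  \<open>M\<^sub>1 + M\<^sub>2\<close> is closed iff \<open>P\<^sub>1 - P\<^sub>2\<close> is bounded below on \<open>G\<close>. If it is, then \<open>T\<close> is a strict
  contraction on \<open>G\<close>. If it is not, then \<open>G\<close> contains unit vectors almost fixed by both
  \<open>T\<close> and its adjoint, and a geometrically weighted sum \<open>x\<close> of such vectors, living on widely
  separated time scales, makes \<open>Re \<langle>T\<^sup>n x, x\<rangle>\<close> decay as slowly as desired.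
\<close>

subsection \<open>Bounded decompositions in a closed sum of subspaces\<close>

instance complex_hilbert \<subseteq> banach ..

lemma suminf_in_closed_subspace:
  fixes f :: "nat \<Rightarrow> 'a::real_normed_vector"
  assumes "subspace M" "closed M" "\<And>n. f n \<in> M" "summable f"
  shows "suminf f \<in> M"
proof (rule closed_sequentially[OF assms(2) _ summable_LIMSEQ[OF assms(4)]])
  show "sum f {..<n} \<in> M" for n
    using assms(1,3) by (rule subspace_sum)
qed

lemma geometric_half_sums: "(\<lambda>n. c * (1/2) ^ n) sums (2 * c :: real)"
  using sums_mult[OF geometric_sums[of "1/2::real"], of c] by (simp add: mult.commute)

lemma subspace_set_plus:
  fixes M N :: "'a::real_vector set"
  assumes "subspace M" "subspace N"
  shows "subspace (M + N)"
proof -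
  have "M + N = {x + y |x y. x \<in> M \<and> y \<in> N}" by (auto simp: set_plus_def)
  then show ?thesis using subspace_sums[OF assms] by simp
qed

text \<open>First half of the open mapping argument. The complete space \<open>M1 + M2\<close> is
  covered by the closures of the sets \<open>S n\<close>, so by Baire's theorem one closure has
  relative interior. Subtracting two approximants taken there decomposes all small vectors up to a
  fixed error; scaling treats the others.\<close>

lemma approximate_decomposition:
  fixes M1 M2 :: "'a::banach set"
  assumes M: "subspace M1" "subspace M2" and cl: "closed (M1 + M2)"
  shows "\<exists>K>0. \<forall>z\<in>M1 + M2. \<exists>a\<in>M1. \<exists>b\<in>M2.
    norm a \<le> K * norm z \<and> norm b \<le> K * norm z \<and> norm (z - a - b) \<le> norm z / 2"
proof -
  define Z where "Z = M1 + M2"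
  have subZ: "subspace Z" unfolding Z_def by (rule subspace_set_plus[OF M])
  define S where "S n = {a + b |a b. a \<in> M1 \<and> b \<in> M2 \<and> norm a \<le> real n \<and> norm b \<le> real n}" for n
  have SZ: "S n \<subseteq> Z" for n unfolding S_def Z_def by (auto intro: set_plus_intro)
  have clSZ: "closure (S n) \<subseteq> Z" for n
    using closure_minimal[OF SZ] cl by (simp add: Z_def)
  have cover: "Z \<subseteq> (\<Union>n. closure (S n))"
  proof
    fix z assume "z \<in> Z"
    then obtain a b where ab: "a \<in> M1" "b \<in> M2" "z = a + b" unfolding Z_def by (auto elim: set_plus_elim)
    obtain n where "max (norm a) (norm b) \<le> real n" using real_arch_simple by blast
    then have "z \<in> S n" using ab by (auto simp: S_def)
    then show "z \<in> (\<Union>n. closure (S n))" using closure_subset by blast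
  qed
  have cm: "completely_metrizable_space (top_of_set Z)"
    using completely_metrizable_space_closedin[of "euclidean :: 'a topology" Z] cl
      completely_metrizable_space_euclidean by (simp add: Z_def)
  have "\<exists>n. (top_of_set Z) interior_of (closure (S n)) \<noteq> {}"
  proof (rule ccontr)
    assume "\<nexists>n. (top_of_set Z) interior_of (closure (S n)) \<noteq> {}"
    then have "(top_of_set Z) interior_of (\<Union>(range (\<lambda>n. closure (S n)))) = {}"
      by (intro Baire_category_alt disjI1 cm) (auto intro: closed_subset[OF clSZ])
    moreover have "\<Union>(range (\<lambda>n. closure (S n))) = topspace (top_of_set Z)"
      using cover clSZ by auto
    ultimately have "Z = {}" by (simp add: interior_of_topspace[of "top_of_set Z", simplified])
    then show False using subspace_0[OF subZ] by auto
  qed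
  then obtain n z0 where "z0 \<in> (top_of_set Z) interior_of (closure (S n))" by blast
  then obtain U where U: "openin (top_of_set Z) U" "z0 \<in> U" "U \<subseteq> closure (S n)"
    by (auto simp: interior_of_def)
  then obtain r where r: "r > 0" "\<And>y. y \<in> Z \<Longrightarrow> dist y z0 < r \<Longrightarrow> y \<in> closure (S n)"
    unfolding openin_euclidean_subtopology_iff by (meson subsetD)
  have z0: "z0 \<in> Z" "z0 \<in> closure (S n)" using U openin_subset[OF U(1)] by auto
  have small: "\<exists>a\<in>M1. \<exists>b\<in>M2. norm a \<le> 2 * real n \<and> norm b \<le> 2 * real n \<and> norm (z - a - b) < r / 4"
    if z: "z \<in> Z" "norm z < r" for z
  proof -
    have r8: "r / 8 > 0" using r(1) by simp
    have "z0 + z \<in> closure (S n)"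
      using r(2)[of "z0 + z"] z z0 subspace_add[OF subZ] by (simp add: dist_norm)
    then obtain s where s: "s \<in> S n" "dist s (z0 + z) < r / 8"
      unfolding closure_approachable using r8 by blast
    obtain t where t: "t \<in> S n" "dist t z0 < r / 8"
      using z0(2) r8 unfolding closure_approachable by blast
    obtain a b where ab: "s = a + b" "a \<in> M1" "b \<in> M2" "norm a \<le> real n" "norm b \<le> real n"
      using s by (auto simp: S_def)
    obtain a' b' where ab': "t = a' + b'" "a' \<in> M1" "b' \<in> M2" "norm a' \<le> real n" "norm b' \<le> real n"
      using t by (auto simp: S_def)
    have "z - (a - a') - (b - b') = (t - z0) - (s - (z0 + z))" using ab ab' by simp
    then have "norm (z - (a - a') - (b - b')) \<le> dist t z0 + dist s (z0 + z)"
      unfolding dist_norm by (simp only: norm_triangle_ineq4)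
    then have "norm (z - (a - a') - (b - b')) < r / 4" using s(2) t(2) by linarith
    moreover have "norm (a - a') \<le> 2 * real n" "norm (b - b') \<le> 2 * real n"
      using ab ab' norm_triangle_ineq4[of a a'] norm_triangle_ineq4[of b b'] by linarith+
    moreover have "a - a' \<in> M1" "b - b' \<in> M2"
      using ab ab' by (auto intro: subspace_diff M)
    ultimately show ?thesis by blast
  qed
  \<comment> \<open>The bound \<open>2 * n\<close> at norm \<open>r / 2\<close> scales to
    \<open>4 * n / r\<close>; the added 1 keeps \<open>K\<close> positive when
    \<open>n = 0\<close>.\<close>
  define K where "K = 4 * real n / r + 1"
  have K: "K > 0" using r by (simp add: K_def add_nonneg_pos)
  have "\<exists>a\<in>M1. \<exists>b\<in>M2. norm a \<le> K * norm z \<and> norm b \<le> K * norm z \<and> norm (z - a - b) \<le> norm z / 2"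
    if z: "z \<in> Z" for z
  proof (cases "z = 0")
    case True
    then show ?thesis using subspace_0[OF M(1)] subspace_0[OF M(2)] by (intro bexI[of _ 0]) auto
  next
    case False
    \<comment> \<open>Division by \<open>c\<close> produces norm \<open>r / 2\<close>, and the error
      \<open>r / 4\<close> scales back to \<open>norm z / 2\<close>.\<close>
    define c where "c = 2 * norm z / r"
    have c: "c > 0" using False r by (simp add: c_def)
    have "norm (z /\<^sub>R c) < r" using r False by (simp add: c_def field_simps)
    then obtain a b where ab: "a \<in> M1" "b \<in> M2" "norm a \<le> 2 * real n" "norm b \<le> 2 * real n"
        "norm (z /\<^sub>R c - a - b) < r / 4"
      using small[of "z /\<^sub>R c"] z subspace_mul[OF subZ] by blast
    have le: "c * (2 * real n) \<le> K * norm z"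
      using r by (simp add: c_def K_def algebra_simps)
    have "norm (c *\<^sub>R a) \<le> K * norm z" "norm (c *\<^sub>R b) \<le> K * norm z"
      using c mult_left_mono[OF ab(3), of c] mult_left_mono[OF ab(4), of c]
      by (auto intro: order_trans[OF _ le])
    moreover have "z - c *\<^sub>R a - c *\<^sub>R b = c *\<^sub>R (z /\<^sub>R c - a - b)"
      using c by (simp add: scaleR_diff_right)
    then have "norm (z - c *\<^sub>R a - c *\<^sub>R b) \<le> norm z / 2"
      using c ab(5) mult_left_mono[of "norm (z /\<^sub>R c - a - b)" "r/4" c] r
      by (simp add: c_def)
    ultimately show ?thesis using ab subspace_mul[OF M(1)] subspace_mul[OF M(2)] by blast
  qed
  then have "\<forall>z\<in>M1 + M2. \<exists>a\<in>M1. \<exists>b\<in>M2.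
      norm a \<le> K * norm z \<and> norm b \<le> K * norm z \<and> norm (z - a - b) \<le> norm z / 2"
    unfolding Z_def by (rule ballI)
  with K show ?thesis by (intro exI conjI)
qed

text \<open>Second half: the residual is decomposed again and again. It halves each time, so the
  pieces form two series dominated by geometric ones, with limits in the closed summands and the
  constant doubled.\<close>

lemma closed_sum_bounded_decomposition:
  fixes M1 M2 :: "'a::banach set"
  assumes M: "subspace M1" "subspace M2" and cl: "closed M1" "closed M2" "closed (M1 + M2)"
  shows "\<exists>K>0. \<forall>z\<in>M1 + M2. \<exists>a\<in>M1. \<exists>b\<in>M2. z = a + b \<and> norm a \<le> K * norm z \<and> norm b \<le> K * norm z"
proof -
  obtain K where K: "K > 0" and ex: "\<forall>z\<in>M1 + M2. \<exists>a\<in>M1. \<exists>b\<in>M2.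
    norm a \<le> K * norm z \<and> norm b \<le> K * norm z \<and> norm (z - a - b) \<le> norm z / 2"
    using approximate_decomposition[OF M cl(3)] by blast
  then obtain f where "\<forall>z\<in>M1 + M2. f z \<in> M1 \<and> (\<exists>b\<in>M2. norm (f z) \<le> K * norm z \<and>
     norm b \<le> K * norm z \<and> norm (z - f z - b) \<le> norm z / 2)" by metis
  then obtain g where fg: "\<And>z. z \<in> M1 + M2 \<Longrightarrow> f z \<in> M1 \<and> g z \<in> M2 \<and> norm (f z) \<le> K * norm z \<and>
     norm (g z) \<le> K * norm z \<and> norm (z - f z - g z) \<le> norm z / 2" by metis
  define h where "h z = z - f z - g z" for z
  have sub: "subspace (M1 + M2)" by (rule subspace_set_plus[OF M])
  have "\<exists>a\<in>M1. \<exists>b\<in>M2. z = a + b \<and> norm a \<le> (2*K) * norm z \<and> norm b \<le> (2*K) * norm z"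
    if z: "z \<in> M1 + M2" for z
  proof -
    define w where "w k = (h ^^ k) z" for k
    have w: "w k \<in> M1 + M2 \<and> norm (w k) \<le> norm z * (1/2) ^ k" for k
    proof (induction k)
      case 0
      then show ?case using z by (simp add: w_def)
    next
      case (Suc k)
      have eq: "w (Suc k) = w k - (f (w k) + g (w k))" by (simp add: w_def h_def)
      have "f (w k) + g (w k) \<in> M1 + M2" using fg Suc by (blast intro: set_plus_intro)
      moreover have "norm (w (Suc k)) \<le> norm (w k) / 2" using fg[of "w k"] Suc
        by (simp add: eq algebra_simps)
      ultimately show ?case using Suc subspace_diff[OF sub] by (simp add: eq)
    qed
    have "K * norm (w k) \<le> (K * norm z) * (1/2)^k" for k
      using mult_left_mono[of "norm (w k)" "norm z * (1/2)^k" K] w[of k] K by (simp add: mult.assoc)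
    then have bnd: "norm (f (w k)) \<le> (K * norm z) * (1/2)^k" "norm (g (w k)) \<le> (K * norm z) * (1/2)^k" for k
      using fg w by (meson order_trans)+
    note gs = geometric_half_sums[of "K * norm z"]
    have sf: "summable (\<lambda>k. f (w k))" "summable (\<lambda>k. g (w k))"
      by (rule summable_comparison_test'[OF sums_summable[OF gs]], rule bnd)+
    have "w \<longlonglongrightarrow> 0"
      by (rule Lim_null_comparison[of _ "\<lambda>k. norm z * (1/2)^k"])
        (use w in \<open>auto intro!: tendsto_mult_right_zero LIMSEQ_realpow_zero\<close>)
    then have "(\<lambda>k. w k - w (Suc k)) sums (w 0 - 0)" by (rule telescope_sums')
    moreover have "w k - w (Suc k) = f (w k) + g (w k)" for k by (simp add: w_def h_def)
    ultimately have "(\<lambda>k. f (w k) + g (w k)) sums z" by (simp add: w_def)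
    moreover have "(\<lambda>k. f (w k) + g (w k)) sums (suminf (\<lambda>k. f (w k)) + suminf (\<lambda>k. g (w k)))"
      using sf by (intro sums_add summable_sums)
    ultimately have "z = suminf (\<lambda>k. f (w k)) + suminf (\<lambda>k. g (w k))" by (rule sums_unique2)
    moreover have "norm (suminf (\<lambda>k. f (w k))) \<le> 2 * K * norm z"
      "norm (suminf (\<lambda>k. g (w k))) \<le> 2 * K * norm z"
      using norm_sums_le[OF summable_sums[OF sf(1)] gs bnd(1)] norm_sums_le[OF summable_sums[OF sf(2)] gs bnd(2)] by auto
    ultimately show ?thesis
      using suminf_in_closed_subspace[OF M(1) cl(1) _ sf(1)] suminf_in_closed_subspace[OF M(2) cl(2) _ sf(2)] fg w by blast
  qed
  then have "\<forall>z\<in>M1 + M2. \<exists>a\<in>M1. \<exists>b\<in>M2.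
      z = a + b \<and> norm a \<le> (2*K) * norm z \<and> norm b \<le> (2*K) * norm z"
    by (rule ballI)
  moreover have "2 * K > 0" using K by simp
  ultimately show ?thesis by (intro exI conjI)
qed

subsection \<open>Averaged isometries\<close>

text \<open>A minimising sequence for the distance to \<open>M\<close> is Cauchy by the
  parallelogram law, and its limit is a nearest point; moving from there along \<open>z\<close>
  cannot reduce the distance, which forces orthogonality.\<close>

theorem orthogonal_projection_exists:
  fixes M :: "'a::{real_inner,banach} set"
  assumes M: "subspace M" and cl: "closed M"
  shows "\<exists>y\<in>M. \<forall>z\<in>M. inner (x - y) z = 0"
proof -
  define D where "D = infdist x M"
  have ne: "M \<noteq> {}" using subspace_0[OF M] by auto
  have D0: "0 \<le> D" by (simp add: D_def infdist_nonneg)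
  have D_le: "D\<^sup>2 \<le> (norm (x - m))\<^sup>2" if "m \<in> M" for m
    using infdist_le[OF that, of x] D0 by (intro power_mono) (auto simp: D_def dist_norm)
  have "\<exists>m\<in>M. norm (x - m) < D + 1 / real (Suc n)" for n
  proof (rule ccontr)
    assume "\<not> ?thesis"
    then have "D + 1 / real (Suc n) \<le> infdist x M"
      unfolding infdist_notempty[OF ne] by (intro cINF_greatest ne) (auto simp: dist_norm not_less)
    then show False by (simp add: D_def)
  qed
  then obtain y where yM: "\<And>n. y n \<in> M" and yD: "\<And>n. norm (x - y n) < D + 1 / real (Suc n)"
    by metis
  define e where "e n = (D + 1 / real (Suc n))\<^sup>2 - D\<^sup>2" for n
  have e0: "e \<longlonglongrightarrow> 0"
  proof -
    have "(\<lambda>n. (D + 1 / real (Suc n))\<^sup>2 - D\<^sup>2) \<longlonglongrightarrow> (D + 0)\<^sup>2 - D\<^sup>2"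
      by (intro tendsto_intros lim_1_over_n LIMSEQ_Suc[OF lim_1_over_n])
    then show ?thesis by (simp add: e_def[abs_def])
  qed
  have ye: "(norm (x - y n))\<^sup>2 \<le> D\<^sup>2 + e n" for n
    using yD[of n] D0 by (auto simp: e_def intro: power_mono less_imp_le)
  have dist_y: "(norm (y m - y n))\<^sup>2 \<le> 2 * e m + 2 * e n" for m n
  proof -
    \<comment> \<open>The midpoint is no closer to \<open>x\<close> than \<open>D\<close>, so the
      parallelogram law bounds \<open>y m - y n\<close> by the two excesses.\<close>
    have "(1/2) *\<^sub>R (y m + y n) \<in> M" by (intro subspace_mul subspace_add M yM)
    from D_le[OF this]
    have "4 * D\<^sup>2 \<le> 4 * (norm (x - (1/2) *\<^sub>R (y m + y n)))\<^sup>2" by simp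
    also have "\<dots> = 2 * (norm (x - y m))\<^sup>2 + 2 * (norm (x - y n))\<^sup>2 - (norm (y m - y n))\<^sup>2"
      unfolding power2_norm_eq_inner by (simp add: inner_simps inner_commute algebra_simps)
    finally show ?thesis using ye[of m] ye[of n] by linarith
  qed
  have "Cauchy y"
  proof (rule CauchyI)
    fix r :: real assume r: "r > 0"
    then have "eventually (\<lambda>n. e n < r\<^sup>2 / 4) sequentially"
      using order_tendstoD(2)[OF e0, of "r\<^sup>2/4"] by simp
    then obtain N where N: "\<And>n. n \<ge> N \<Longrightarrow> e n < r\<^sup>2 / 4" by (auto simp: eventually_sequentially)
    have "norm (y m - y n) < r" if "m \<ge> N" "n \<ge> N" for m n
    proof (rule power2_less_imp_less)
      show "(norm (y m - y n))\<^sup>2 < r\<^sup>2" using dist_y[of m n] N[OF that(1)] N[OF that(2)] by linarith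
    qed (use r in simp)
    then show "\<exists>N. \<forall>m\<ge>N. \<forall>n\<ge>N. norm (y m - y n) < r" by blast
  qed
  then obtain l where l: "y \<longlonglongrightarrow> l" using Cauchy_convergent convergent_def by blast
  have lM: "l \<in> M" by (rule closed_sequentially[OF cl yM l])
  have "(\<lambda>n. (norm (x - y n))\<^sup>2) \<longlonglongrightarrow> (norm (x - l))\<^sup>2" by (intro tendsto_intros l)
  moreover have "(\<lambda>n. D\<^sup>2 + e n) \<longlonglongrightarrow> D\<^sup>2 + 0" by (intro tendsto_intros e0)
  ultimately have lD: "(norm (x - l))\<^sup>2 \<le> D\<^sup>2"
    using ye by (auto intro: LIMSEQ_le)
  have "inner (x - l) z = 0" if z: "z \<in> M" for z
  proof (cases "z = 0")
    case False
    \<comment> \<open>The best step along \<open>z\<close>: it would lower the squared distance by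
      \<open>(inner (x - l) z)\<^sup>2 / inner z z\<close>.\<close>
    define t where "t = inner (x - l) z / inner z z"
    have "D\<^sup>2 \<le> (norm (x - (l + t *\<^sub>R z)))\<^sup>2"
      by (intro D_le subspace_add subspace_mul M lM z)
    also have "\<dots> = (norm (x - l))\<^sup>2 - (inner (x - l) z)\<^sup>2 / inner z z"
      using False unfolding power2_norm_eq_inner t_def
      by (simp add: inner_simps inner_commute power2_eq_square field_simps)
    finally have "(inner (x - l) z)\<^sup>2 / inner z z \<le> 0" using lD by linarith
    moreover have "inner z z > 0" using False by simp
    ultimately have "(inner (x - l) z)\<^sup>2 \<le> 0 * inner z z" by (simp only: pos_divide_le_eq)
    then show ?thesis by simp
  qed simp
  with lM show ?thesis by blast
qed

text \<open>The unit in which orbit decay is measured; the shift by one makes it finite at 0, with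
  value 1.\<close>

definition decay :: "nat \<Rightarrow> real" where
  "decay n = 1 / sqrt (real n + 1)"

lemma decay_pos: "0 < decay n" and decay_le_1: "decay n \<le> 1"
  by (auto simp: decay_def intro!: add_nonneg_pos)

lemma decay_antimono: "m \<le> n \<Longrightarrow> decay n \<le> decay m"
  by (auto simp: decay_def intro!: divide_left_mono mult_pos_pos)

lemma decay_half: "decay (n div 2) \<le> 2 * decay n"
proof -
  have "sqrt (real n + 1) \<le> sqrt (4 * (real (n div 2) + 1))" by simp
  also have "\<dots> = 2 * sqrt (real (n div 2) + 1)" unfolding real_sqrt_mult by simp
  finally show ?thesis by (simp add: decay_def field_simps)
qed

lemma decay_tendsto_0: "decay \<longlonglongrightarrow> 0"
proof -
  have "(\<lambda>n. sqrt (1 / real (Suc n))) \<longlonglongrightarrow> sqrt 0"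
    by (intro tendsto_intros LIMSEQ_Suc[OF lim_1_over_n])
  then show ?thesis by (simp add: decay_def[abs_def] real_sqrt_divide add.commute)
qed

text \<open>The operators \<open>(I + U) / 2\<close> with \<open>U\<close> isometric are those satisfying \<open>pythagoras\<close>.\<close>

locale averaged_isometry =
  fixes T :: "'a::{real_inner,banach} \<Rightarrow> 'a"
  assumes linear: "linear T"
    and pythagoras: "(norm (T x))\<^sup>2 + (norm (x - T x))\<^sup>2 = (norm x)\<^sup>2"
begin

section \<open>Orbits of averaged isometries and strong convergence\<close>

lemma contraction: "norm (T x) \<le> norm x"
  by (rule power2_le_imp_le) (use pythagoras[of x] zero_le_power2[of "norm (x - T x)"] in \<open>linarith, simp\<close>)

lemma linear_pow: "Real_Vector_Spaces.linear (T ^^ n)"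
proof (induction n)
  case 0
  show ?case by (simp add: linear_id[unfolded id_def] id_def)
next
  case (Suc n)
  show ?case unfolding funpow.simps by (rule linear_compose[OF Suc linear])
qed

lemma contraction_pow: "norm ((T ^^ n) x) \<le> norm x"
  by (induction n) (auto intro: order_trans contraction)

lemma pow_antimono: "m \<le> n \<Longrightarrow> norm ((T ^^ n) x) \<le> norm ((T ^^ m) x)"
  by (metis contraction_pow funpow_add le_add_diff_inverse2 o_apply)

lemma bounded_linear_pow: "bounded_linear (T ^^ n)"
  by (rule bounded_linear_intro[of _ 1]) (auto simp: linear_add linear_scale linear_pow contraction_pow)

lemma pow_diff: "(T ^^ n) (x - y) = (T ^^ n) x - (T ^^ n) y"
  by (rule linear_diff[OF linear_pow])

text \<open>The squared norms of the defects along the orbit telescope to at most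
  \<open>(norm x)\<^sup>2\<close>, and they decrease, so the last of \<open>n + 1\<close> terms is
  at most the average.\<close>

lemma pow_defect_le: "norm ((T ^^ n) (x - T x)) \<le> decay n * norm x"
proof (rule power2_le_imp_le)
  define a where "a k = (norm ((T ^^ k) (x - T x)))\<^sup>2" for k
  have a: "a k = (norm ((T ^^ k) x))\<^sup>2 - (norm ((T ^^ Suc k) x))\<^sup>2" for k
    using pythagoras[of "(T ^^ k) x"] by (simp add: a_def pow_diff funpow_swap1)
  have "(real n + 1) * a n = (\<Sum>k<Suc n. a n)" by simp
  also have "\<dots> \<le> (\<Sum>k<Suc n. a k)"
    by (intro sum_mono) (auto simp: a_def intro!: power_mono pow_antimono)
  also have "\<dots> = (norm x)\<^sup>2 - (norm ((T ^^ Suc n) x))\<^sup>2"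
    unfolding a by (subst sum_lessThan_telescope') simp
  also have "\<dots> \<le> (norm x)\<^sup>2" by simp
  finally show "(norm ((T ^^ n) (x - T x)))\<^sup>2 \<le> (decay n * norm x)\<^sup>2"
    by (simp add: a_def decay_def power_mult_distrib power_divide field_simps)
qed (simp add: decay_pos less_imp_le)

lemma pow_tendsto_0_subspace: "subspace {x. (\<lambda>n. (T ^^ n) x) \<longlonglongrightarrow> 0}"
proof (rule subspaceI, safe)
  fix c :: real and x
  assume "(\<lambda>n. (T ^^ n) x) \<longlonglongrightarrow> 0"
  from tendsto_scaleR[OF tendsto_const[of c] this] show "(\<lambda>n. (T ^^ n) (c *\<^sub>R x)) \<longlonglongrightarrow> 0"
    by (simp add: linear_scale[OF linear_pow])
qed (auto simp: linear_0[OF linear_pow] linear_add[OF linear_pow] intro: tendsto_add_zero)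

lemma pow_tendsto_0_closed: "closed {x. (\<lambda>n. (T ^^ n) x) \<longlonglongrightarrow> 0}"
proof (rule closed_sequential_limits[THEN iffD2], safe)
  fix f x assume f: "\<forall>k. f k \<in> {x. (\<lambda>n. (T ^^ n) x) \<longlonglongrightarrow> 0}" and x: "f \<longlonglongrightarrow> x"
  show "(\<lambda>n. (T ^^ n) x) \<longlonglongrightarrow> 0"
  proof (rule LIMSEQ_I)
    fix e :: real assume e: "e > 0"
    obtain k where k: "norm (f k - x) < e / 2"
      using LIMSEQ_D[OF x, of "e/2"] e by auto
    obtain N where N: "\<And>n. n \<ge> N \<Longrightarrow> norm ((T ^^ n) (f k)) < e / 2"
      using LIMSEQ_D[of "\<lambda>n. (T ^^ n) (f k)" 0 "e/2"] f e by auto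
    have "norm ((T ^^ n) x) < e" if "n \<ge> N" for n
      using N[OF that] k contraction_pow[of n "f k - x"] norm_triangle_ineq4[of "(T ^^ n) (f k)" "(T ^^ n) (f k - x)"]
      by (simp add: pow_diff)
    then show "\<exists>N. \<forall>n\<ge>N. norm ((T ^^ n) x - 0) < e" by auto
  qed
qed

text \<open>The vectors with null orbits form a closed subspace \<open>R\<close> containing the
  range of \<open>I - T\<close>. Hence the component of \<open>x\<close> orthogonal to
  \<open>R\<close> is fixed by the adjoint; being also orthogonal to \<open>x\<close>, it
  vanishes.\<close>

lemma pow_tendsto_0:
  assumes adj: "\<And>u v. inner (T u) v = inner u (T' v)"
    and orth: "\<And>z. T' z = z \<Longrightarrow> inner x z = 0"
  shows "(\<lambda>n. (T ^^ n) x) \<longlonglongrightarrow> 0"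
proof -
  define R where "R = {x. (\<lambda>n. (T ^^ n) x) \<longlonglongrightarrow> 0}"
  obtain y where y: "y \<in> R" "\<And>z. z \<in> R \<Longrightarrow> inner (x - y) z = 0"
    using orthogonal_projection_exists[of R x] pow_tendsto_0_subspace pow_tendsto_0_closed
    by (auto simp: R_def)
  have range: "w - T w \<in> R" for w
    unfolding R_def mem_Collect_eq
    by (rule Lim_null_comparison[of _ "\<lambda>n. decay n * norm w"])
      (auto intro!: tendsto_mult_left_zero decay_tendsto_0 simp: pow_defect_le)
  have "inner w ((x - y) - T' (x - y)) = 0" for w
    using y(2)[OF range[of w]] adj[of w "x - y"] by (simp add: inner_diff_left inner_diff_right inner_commute)
  then have "T' (x - y) = x - y" by (metis inner_eq_zero_iff eq_iff_diff_eq_0)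
  then have "inner x (x - y) = 0" by (rule orth)
  moreover have "inner (x - y) y = 0" using y by blast
  ultimately have "inner (x - y) (x - y) = 0" by (simp add: inner_diff_left inner_diff_right inner_commute)
  then show ?thesis using y(1) by (simp add: R_def)
qed

section \<open>Polynomial decay classes and the density of rapidly decaying vectors\<close>

definition decays :: "nat \<Rightarrow> 'a \<Rightarrow> bool" where
  "decays k x \<longleftrightarrow> (\<exists>C. \<forall>n. norm ((T ^^ n) x) \<le> C * decay n ^ k)"

lemma decaysE:
  assumes "decays k x"
  obtains C where "C \<ge> 0" "\<And>n. norm ((T ^^ n) x) \<le> C * decay n ^ k"
proof -
  obtain C where C: "\<And>n. norm ((T ^^ n) x) \<le> C * decay n ^ k" using assms by (auto simp: decays_def)
  have "0 \<le> C * decay 0 ^ k" using C[of 0] norm_ge_zero order_trans by blast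
  then have "C \<ge> 0" by (simp add: decay_def)
  then show ?thesis using C that by blast
qed

lemma decays_add:
  assumes "decays k x" "decays k y"
  shows "decays k (x + y)"
proof -
  obtain C D where C: "\<And>n. norm ((T ^^ n) x) \<le> C * decay n ^ k" and D: "\<And>n. norm ((T ^^ n) y) \<le> D * decay n ^ k"
    using assms by (auto simp: decays_def)
  have "norm ((T ^^ n) (x + y)) \<le> (C + D) * decay n ^ k" for n
    unfolding linear_add[OF linear_pow] using C[of n] D[of n] norm_triangle_ineq[of "(T ^^ n) x" "(T ^^ n) y"]
    by (simp add: distrib_right)
  then show ?thesis by (auto simp: decays_def)
qed

lemma decays_image:
  assumes "decays k x"
  shows "decays k (T x)"
proof -
  obtain C where C: "\<And>n. norm ((T ^^ n) x) \<le> C * decay n ^ k" using assms by (auto simp: decays_def)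
  have "norm ((T ^^ n) (T x)) \<le> C * decay n ^ k" for n
    using C[of n] pow_antimono[of n "Suc n" x] by (simp add: funpow_swap1)
  then show ?thesis by (auto simp: decays_def)
qed

text \<open>Half of the time is spent on the decay of \<open>x\<close> itself, the other half on
  \<open>pow_defect_le\<close>, which contributes the additional factor; halving the time costs only
  a constant by \<open>decay_half\<close>.\<close>

lemma decays_defect:
  assumes "decays k x"
  shows "decays (Suc k) (x - T x)"
proof -
  obtain C where C: "C \<ge> 0" "\<And>n. norm ((T ^^ n) x) \<le> C * decay n ^ k"
    using assms by (rule decaysE) blast
  have "norm ((T ^^ n) (x - T x)) \<le> (C * 2 ^ Suc k) * decay n ^ Suc k" for n
  proof -
    define m where "m = n div 2"
    \<comment> \<open>Rounding down leaves the longer half for \<open>x\<close>, so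
      \<open>decay (n - m)\<close> is at most \<open>decay m\<close>.\<close>
    have m: "m \<le> n - m" "n = m + (n - m)" by (auto simp: m_def)
    have "(T ^^ n) (x - T x) = (T ^^ m) ((T ^^ (n - m)) x - T ((T ^^ (n - m)) x))"
      by (subst m(2)) (simp add: funpow_add pow_diff funpow_swap1)
    then have "norm ((T ^^ n) (x - T x)) \<le> decay m * norm ((T ^^ (n - m)) x)"
      by (simp only: pow_defect_le)
    also have "\<dots> \<le> decay m * (C * decay (n - m) ^ k)"
      by (intro mult_left_mono C less_imp_le[OF decay_pos])
    also have "\<dots> \<le> decay m * (C * decay m ^ k)"
      by (intro mult_left_mono power_mono decay_antimono m C less_imp_le[OF decay_pos])
    also have "\<dots> = C * decay m ^ Suc k" by simp
    also have "\<dots> \<le> C * (2 * decay n) ^ Suc k"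
      unfolding m_def by (intro mult_left_mono power_mono decay_half C less_imp_le[OF decay_pos])
    finally show ?thesis by (simp only: power_mult_distrib mult.assoc)
  qed
  then show ?thesis by (auto simp: decays_def)
qed

lemma decays_diff_pow:
  assumes "decays k x"
  shows "decays (Suc k) (x - (T ^^ m) x)"
proof (induction m)
  case 0
  show ?case by (auto simp: decays_def linear_0[OF linear_pow] intro: exI[of _ 0])
next
  case (Suc m)
  have eq: "x - (T ^^ Suc m) x = (x - T x) + T (x - (T ^^ m) x)"
    by (simp add: linear_diff[OF linear])
  show ?case unfolding eq by (rule decays_add[OF decays_defect[OF assms] decays_image[OF Suc]])
qed

text \<open>One factor of \<^const>\<open>decay\<close> is spent on making the correction \<open>T\<^sup>m x\<close> small.\<close>

lemma decays_improve:
  assumes x: "decays k x" "(\<lambda>n. (T ^^ n) x) \<longlonglongrightarrow> 0" and e: "e > 0"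
  shows "\<exists>y. decays (Suc k) y \<and> (\<lambda>n. (T ^^ n) y) \<longlonglongrightarrow> 0 \<and>
    (\<forall>n. norm ((T ^^ n) (y - x)) \<le> e * decay n ^ (k - 1))"
proof -
  obtain m where m: "\<forall>n. norm ((T ^^ n) ((T ^^ m) x)) \<le> e * decay n ^ (k - 1)"
  \<comment> \<open>For \<open>k = 0\<close> the exponent \<open>k - 1\<close> is truncated to 0,
    and smallness comes from convergence of the orbit; otherwise it comes from one factor of the
    decay bound.\<close>
  proof (cases k)
    case 0
    obtain m where "norm ((T ^^ m) x) < e" using LIMSEQ_D[OF x(2) e] by auto
    then have "norm ((T ^^ n) ((T ^^ m) x)) \<le> e * decay n ^ (k - 1)" for n
      using contraction_pow[of n "(T ^^ m) x"] 0 by simp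
    then show ?thesis using that by blast
  next
    case (Suc j)
    obtain C where C: "C \<ge> 0" "\<And>n. norm ((T ^^ n) x) \<le> C * decay n ^ k"
      using x(1) by (rule decaysE) blast
    have "(\<lambda>n. C * decay n) \<longlonglongrightarrow> 0" by (intro tendsto_mult_right_zero decay_tendsto_0)
    from order_tendstoD(2)[OF this e] obtain m where m: "C * decay m < e"
      by (auto simp: eventually_sequentially)
    have "norm ((T ^^ n) ((T ^^ m) x)) \<le> e * decay n ^ (k - 1)" for n
    proof -
      have "norm ((T ^^ n) ((T ^^ m) x)) = norm ((T ^^ (n + m)) x)" by (simp add: funpow_add)
      also have "\<dots> \<le> C * decay (n + m) ^ k" by (rule C)
      also have "\<dots> = (C * decay (n + m)) * decay (n + m) ^ j" by (simp add: Suc)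
      also have "\<dots> \<le> e * decay n ^ j"
      proof (intro mult_mono power_mono decay_antimono)
        have "C * decay (n + m) \<le> C * decay m" by (intro mult_left_mono decay_antimono C) simp
        then show "C * decay (n + m) \<le> e" using m by linarith
      qed (use e in \<open>auto intro: less_imp_le[OF decay_pos] zero_le_power\<close>)
      finally show ?thesis by (simp add: Suc)
    qed
    then show ?thesis using that by blast
  qed
  have "(\<lambda>n. (T ^^ n) ((T ^^ m) x)) \<longlonglongrightarrow> 0"
    using LIMSEQ_ignore_initial_segment[OF x(2), of m] by (simp add: funpow_add)
  then have "(\<lambda>n. (T ^^ n) (x - (T ^^ m) x)) \<longlonglongrightarrow> 0"
    using tendsto_diff[OF x(2)] by (force simp: pow_diff)
  moreover have "(T ^^ n) (x - (T ^^ m) x - x) = - (T ^^ n) ((T ^^ m) x)" for n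
    by (simp add: linear_neg[OF linear_pow])
  ultimately show ?thesis using decays_diff_pow[OF x(1), of m] m
    by (intro exI[of _ "x - (T ^^ m) x"]) simp
qed

text \<open>The \<open>k\<close>-th correction is small in the weighted norm with weight
  \<open>decay n ^ (k - 1)\<close>. The limit therefore differs from each iterate by a vector that
  decays almost as fast as the iterate, and it inherits every decay class.\<close>

lemma rapidly_decaying_dense:
  assumes x: "(\<lambda>n. (T ^^ n) x) \<longlonglongrightarrow> 0" and e: "e > 0"
  shows "\<exists>y. norm (y - x) \<le> e \<and> (\<forall>k. decays k y)"
proof -
  \<comment> \<open>The corrections \<open>d * (1/2)^k\<close> add up to
    \<open>2 * d\<close>.\<close>
  define d where "d = e / 2"
  have d: "d > 0" using e by (simp add: d_def)
  have "\<exists>f. \<forall>k. (decays k (f k) \<and> (\<lambda>n. (T ^^ n) (f k)) \<longlonglongrightarrow> 0 \<and> (k = 0 \<longrightarrow> f k = x)) \<and>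
      (\<forall>n. norm ((T ^^ n) (f (Suc k) - f k)) \<le> (d * (1/2)^k) * decay n ^ (k - 1))"
  proof (rule dependent_nat_choice)
    show "\<exists>y. decays 0 y \<and> (\<lambda>n. (T ^^ n) y) \<longlonglongrightarrow> 0 \<and> (0 = 0 \<longrightarrow> y = x)"
      using x by (auto simp: decays_def intro: contraction_pow)
  next
    fix z k
    assume z: "decays k z \<and> (\<lambda>n. (T ^^ n) z) \<longlonglongrightarrow> 0 \<and> (k = 0 \<longrightarrow> z = x)"
    have "d * (1/2)^k > 0" using d by simp
    with z decays_improve[of k z "d * (1/2)^k"]
    show "\<exists>y. (decays (Suc k) y \<and> (\<lambda>n. (T ^^ n) y) \<longlonglongrightarrow> 0 \<and> (Suc k = 0 \<longrightarrow> y = x)) \<and>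
       (\<forall>n. norm ((T ^^ n) (y - z)) \<le> (d * (1/2)^k) * decay n ^ (k - 1))" by simp
  qed
  then obtain f where f: "\<And>k. decays k (f k)" "f 0 = x"
    and step: "\<And>k n. norm ((T ^^ n) (f (Suc k) - f k)) \<le> (d * (1/2)^k) * decay n ^ (k - 1)"
    by blast
  have "norm (f (Suc k) - f k) \<le> d * (1/2)^k" for k
    using step[of 0 k] by (simp add: decay_def)
  then have "summable (\<lambda>k. f (Suc k) - f k)"
    by (intro summable_comparison_test'[OF sums_summable[OF geometric_half_sums]])
  then have "(\<lambda>n. f 0 + (\<Sum>k<n. f (Suc k) - f k)) \<longlonglongrightarrow> f 0 + (\<Sum>k. f (Suc k) - f k)"
    by (intro tendsto_intros summable_LIMSEQ)
  then obtain y where y: "f \<longlonglongrightarrow> y" by (simp add: sum_lessThan_telescope)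
  have tail: "norm ((T ^^ n) (y - f j)) \<le> (2 * d) * decay n ^ (j - 1)" for n j
  proof -
    have "(\<lambda>i. (T ^^ n) (f (Suc i + j) - f (i + j))) sums (T ^^ n) (y - f j)"
    proof (rule bounded_linear.sums[OF bounded_linear_pow])
      have "(\<lambda>i. f (i + j)) \<longlonglongrightarrow> y" using y by (rule LIMSEQ_ignore_initial_segment)
      from telescope_sums[OF this] show "(\<lambda>i. f (Suc i + j) - f (i + j)) sums (y - f j)" by simp
    qed
    moreover have "norm ((T ^^ n) (f (Suc i + j) - f (i + j))) \<le> (d * decay n ^ (j - 1)) * (1/2) ^ i" for i
    proof -
      have "norm ((T ^^ n) (f (Suc i + j) - f (i + j))) \<le> (d * (1/2)^(i + j)) * decay n ^ (i + j - 1)"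
        using step[of n "i + j"] by simp
      also have "\<dots> \<le> (d * (1/2)^i) * decay n ^ (j - 1)"
        using d decay_pos[of n] decay_le_1[of n]
        by (intro mult_mono power_decreasing) (auto intro: less_imp_le)
      finally show ?thesis by (simp add: mult_ac)
    qed
    ultimately have "norm ((T ^^ n) (y - f j)) \<le> 2 * (d * decay n ^ (j - 1))"
      by (rule norm_sums_le[OF _ geometric_half_sums])
    then show ?thesis by simp
  qed
  have "norm (y - x) \<le> e" using tail[of 0 0] by (simp add: f d_def decay_def)
  moreover have "decays k y" for k
  proof -
    \<comment> \<open>The index \<open>Suc k\<close> is used because \<open>tail\<close> loses one
      power of \<open>decay\<close>.\<close>
    obtain C where C: "C \<ge> 0" "\<And>n. norm ((T ^^ n) (f (Suc k))) \<le> C * decay n ^ Suc k"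
      using f(1) by (rule decaysE) blast
    have "norm ((T ^^ n) y) \<le> (C + 2 * d) * decay n ^ k" for n
    proof -
      have "C * decay n ^ Suc k \<le> C * decay n ^ k"
        using decay_pos[of n] decay_le_1[of n] C by (intro mult_left_mono power_decreasing) auto
      then show ?thesis
        using C(2)[of n] tail[of n "Suc k"] norm_triangle_ineq[of "(T ^^ n) (y - f (Suc k))" "(T ^^ n) (f (Suc k))"]
        by (simp add: pow_diff distrib_right)
    qed
    then show ?thesis by (auto simp: decays_def)
  qed
  ultimately show ?thesis by blast
qed

end

subsection \<open>Slow orbits\<close>

text \<open>A vector that one step hardly moves stays almost fixed up to any prescribed time; this
  lets slow blocks wait.\<close>

lemma (in averaged_isometry) pow_defect_le_mult: "norm (x - (T ^^ n) x) \<le> real n * norm (x - T x)"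
proof (induction n)
  case (Suc n)
  have "x - (T ^^ Suc n) x = (x - (T ^^ n) x) + (T ^^ n) (x - T x)"
    by (simp add: pow_diff funpow_swap1)
  then have "norm (x - (T ^^ Suc n) x) \<le> norm (x - (T ^^ n) x) + norm ((T ^^ n) (x - T x))"
    by (metis norm_triangle_ineq)
  also have "\<dots> \<le> real n * norm (x - T x) + norm (x - T x)"
    using Suc contraction_pow by (intro add_mono)
  finally show ?case by (simp add: distrib_right)
qed simp

locale adjoint_averaged_isometries =
  T: averaged_isometry T + T': averaged_isometry T' for T T' :: "'a::{real_inner,banach} \<Rightarrow> 'a" +
  assumes adjoint: "inner (T u) v = inner u (T' v)"
begin

lemma adjoint_pow: "inner ((T ^^ n) u) v = inner u ((T' ^^ n) v)"
proof (induction n arbitrary: v)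
  case (Suc n)
  have "inner ((T ^^ Suc n) u) v = inner ((T ^^ n) u) (T' v)" by (simp add: adjoint)
  then show ?case by (simp add: Suc funpow_swap1)
qed simp

text \<open>Inductive choice: given the partial sum \<open>U k\<close> and the time
  \<open>m k\<close>, add a block of norm \<open>a k\<close> so nearly fixed that it hardly moves
  until \<open>m k\<close>; then wait until the new partial sum has almost vanished under both
  iterations and \<open>r\<close> is below the next threshold.\<close>

lemma block_sequence_exists:
  fixes r :: "nat \<Rightarrow> real"
  assumes G: "subspace G"
    and conv: "\<And>x. x \<in> G \<Longrightarrow> (\<lambda>n. (T ^^ n) x) \<longlonglongrightarrow> 0" "\<And>x. x \<in> G \<Longrightarrow> (\<lambda>n. (T' ^^ n) x) \<longlonglongrightarrow> 0"
    and approx: "\<And>e. e > 0 \<Longrightarrow> \<exists>x\<in>G. norm x = 1 \<and> norm (x - T x) \<le> e \<and> norm (x - T' x) \<le> e"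
    and r: "r \<longlonglongrightarrow> 0" "\<And>n. r n \<le> c 0"
    and c: "\<And>k. c k > 0" and a: "\<And>k. a k > 0" and d: "\<And>k. d k > 0" and h: "\<And>k. h k > 0"
  obtains U m where "U 0 = 0" "m 0 = 0" "strict_mono m" "\<And>k. U k \<in> G"
    "\<And>k n. m k \<le> n \<Longrightarrow> norm ((T ^^ n) (U k)) \<le> d k"
    "\<And>k n. m k \<le> n \<Longrightarrow> norm ((T' ^^ n) (U k)) \<le> d k"
    "\<And>k n. m k \<le> n \<Longrightarrow> r n \<le> c k"
    "\<And>k. norm (U (Suc k) - U k) = a k"
    "\<And>k n. n \<le> m k \<Longrightarrow> norm ((U (Suc k) - U k) - (T ^^ n) (U (Suc k) - U k)) \<le> h k"
    "\<And>k n. n \<le> m k \<Longrightarrow> norm ((U (Suc k) - U k) - (T' ^^ n) (U (Suc k) - U k)) \<le> h k"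
proof -
  \<comment> \<open>A state is a pair of partial sum and time; \<open>P\<close> is its invariant and
    \<open>Q\<close> relates consecutive states.\<close>
  define P where "P k s \<longleftrightarrow> fst s \<in> G \<and> (\<forall>n\<ge>snd s. norm ((T ^^ n) (fst s)) \<le> d k \<and>
     norm ((T' ^^ n) (fst s)) \<le> d k \<and> r n \<le> c k) \<and> (k = 0 \<longrightarrow> s = (0, 0))"
    for k and s :: "'a \<times> nat"
  define Q where "Q k s t \<longleftrightarrow> snd s < snd t \<and> norm (fst t - fst s) = a k \<and>
     (\<forall>n\<le>snd s. norm ((fst t - fst s) - (T ^^ n) (fst t - fst s)) \<le> h k \<and>
        norm ((fst t - fst s) - (T' ^^ n) (fst t - fst s)) \<le> h k)" for k and s t :: "'a \<times> nat"
  have "\<exists>f. \<forall>k. P k (f k) \<and> Q k (f k) (f (Suc k))"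
  proof (rule dependent_nat_choice)
    show "\<exists>s. P 0 s"
      using r(2) d[of 0] subspace_0[OF G]
      by (intro exI[of _ "(0, 0)"]) (auto simp: P_def linear_0[OF T.linear_pow] linear_0[OF T'.linear_pow])
  next
    fix s k assume s: "P k s"
    obtain u m where um: "s = (u, m)" by fastforce
    note ak = a[of k]
    \<comment> \<open>Over \<open>m\<close> steps a block of norm \<open>a k\<close> moves by at
      most \<open>a k * m * e\<close>, which \<open>e = h k / D\<close> keeps below
      \<open>h k\<close>; the added 1 covers \<open>m = 0\<close>.\<close>
    define D where "D = a k * (real m + 1)"
    define e where "e = h k / D"
    have D: "D > 0" using ak by (simp add: D_def add_nonneg_pos)
    have e: "e > 0" using h[of k] D by (simp add: e_def)
    obtain x where x: "x \<in> G" "norm x = 1" "norm (x - T x) \<le> e" "norm (x - T' x) \<le> e"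
      using approx[OF e] by blast
    define y where "y = a k *\<^sub>R x"
    have time: "a k * (real n * e) \<le> h k" if "n \<le> m" for n
    proof -
      have "a k * (real n * e) \<le> a k * ((real m + 1) * e)"
        using that e ak by (intro mult_left_mono mult_right_mono) auto
      also have "\<dots> = D * e" by (simp add: D_def)
      also have "\<dots> = h k" using D by (simp add: e_def)
      finally show ?thesis .
    qed
    have "norm (y - (T ^^ n) y) = a k * norm (x - (T ^^ n) x)"
      "norm (y - (T' ^^ n) y) = a k * norm (x - (T' ^^ n) x)" for n
      using ak by (auto simp: y_def linear_scale[OF T.linear_pow] linear_scale[OF T'.linear_pow]
          scaleR_diff_right[symmetric])
    moreover have "norm (x - (T ^^ n) x) \<le> real n * e" "norm (x - (T' ^^ n) x) \<le> real n * e" for n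
      using T.pow_defect_le_mult[of x n] T'.pow_defect_le_mult[of x n]
        mult_left_mono[OF x(3), of "real n"] mult_left_mono[OF x(4), of "real n"] by auto
    ultimately have near: "norm (y - (T ^^ n) y) \<le> h k" "norm (y - (T' ^^ n) y) \<le> h k" if "n \<le> m" for n
      using time[OF that] ak by (metis mult_le_cancel_left_pos order_trans)+
    have uy: "u + y \<in> G"
      using s x(1) by (auto simp: P_def um y_def intro: subspace_add subspace_scale G)
    have ev: "eventually (\<lambda>n. norm ((T ^^ n) (u + y)) < d (Suc k) \<and> norm ((T' ^^ n) (u + y)) < d (Suc k)
        \<and> r n < c (Suc k) \<and> m < n) sequentially"
      by (intro eventually_conj order_tendstoD(2)[OF tendsto_norm_zero[OF conv(1)[OF uy]]]
          order_tendstoD(2)[OF tendsto_norm_zero[OF conv(2)[OF uy]]] order_tendstoD(2)[OF r(1)]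
          eventually_gt_at_top c d)
    then obtain N where N: "\<And>n. n \<ge> N \<Longrightarrow> norm ((T ^^ n) (u + y)) < d (Suc k) \<and>
        norm ((T' ^^ n) (u + y)) < d (Suc k) \<and> r n < c (Suc k) \<and> m < n"
      unfolding eventually_sequentially by blast
    have "P (Suc k) (u + y, N)" using uy N by (auto simp: P_def intro: less_imp_le)
    moreover have "Q k s (u + y, N)"
      using N[of N] near ak x(2) by (auto simp: Q_def um y_def)
    ultimately show "\<exists>t. P (Suc k) t \<and> Q k s t" by blast
  qed
  then obtain f where f: "\<And>k. P k (f k)" "\<And>k. Q k (f k) (f (Suc k))" by blast
  show ?thesis
  proof (rule that[of "\<lambda>k. fst (f k)" "\<lambda>k. snd (f k)"])
    show "strict_mono (\<lambda>k. snd (f k))" using f(2) by (auto simp: strict_mono_Suc_iff Q_def)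
  qed (use f in \<open>auto simp: P_def Q_def\<close>)
qed

text \<open>The blocks \<open>U (Suc k) - U k\<close> have size \<open>p ^ k\<close>; up to time \<open>m k\<close> the \<open>k\<close>-th block is
  almost fixed, and from time \<open>m (Suc k)\<close> on it has almost vanished. In between nothing is
  known about it, so the sum of the squares of the next two block sizes has to exceed its own:
  \<open>p = 19/20\<close> is chosen because \<open>p\<^sup>2 + p\<^sup>4 > 1\<close>.\<close>

lemma slow_orbit_bounded:
  fixes r :: "nat \<Rightarrow> real"
  assumes G: "subspace G" "closed G"
    and conv: "\<And>x. x \<in> G \<Longrightarrow> (\<lambda>n. (T ^^ n) x) \<longlonglongrightarrow> 0" "\<And>x. x \<in> G \<Longrightarrow> (\<lambda>n. (T' ^^ n) x) \<longlonglongrightarrow> 0"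
    and approx: "\<And>e. e > 0 \<Longrightarrow> \<exists>x\<in>G. norm x = 1 \<and> norm (x - T x) \<le> e \<and> norm (x - T' x) \<le> e"
    and r: "r \<longlonglongrightarrow> 0" "\<And>n. r n \<le> 1/5"
  shows "\<exists>x\<in>G. \<forall>n. r n \<le> inner ((T ^^ n) x) x"
proof -
  \<comment> \<open>Here \<open>q = p\<^sup>2\<close> is the ratio of the squared block sizes, and
    every error is measured by \<open>d k\<close>, a small fraction of \<open>q ^ k\<close>.\<close>
  define p q :: real where "p = 19/20" and "q = 361/400"
  define d where "d k = q ^ k / 2000" for k
  have q: "q ^ k = p ^ k * p ^ k" for k
    unfolding power_mult_distrib[symmetric] by (simp add: p_def q_def)
  have q_pos: "q ^ k > 0" for k by (simp add: q_def)
  obtain U m where U0: "U 0 = 0" and m0: "m 0 = 0" and m: "strict_mono m" and UG: "\<And>k. U k \<in> G"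
    and late: "\<And>k n. m k \<le> n \<Longrightarrow> norm ((T ^^ n) (U k)) \<le> d k"
      "\<And>k n. m k \<le> n \<Longrightarrow> norm ((T' ^^ n) (U k)) \<le> d k"
    and rU: "\<And>k n. m k \<le> n \<Longrightarrow> r n \<le> 1/5 * q ^ k"
    and size: "\<And>k. norm (U (Suc k) - U k) = p ^ k"
    \<comment> \<open>Since \<open>1 - q = 39/400\<close>, these errors, summed from index
      \<open>k\<close> on, give exactly \<open>d k\<close>.\<close>
    and early: "\<And>k n. n \<le> m k \<Longrightarrow> norm ((U (Suc k) - U k) - (T ^^ n) (U (Suc k) - U k)) \<le> 39/400/2000 * q ^ k"
      "\<And>k n. n \<le> m k \<Longrightarrow> norm ((U (Suc k) - U k) - (T' ^^ n) (U (Suc k) - U k)) \<le> 39/400/2000 * q ^ k"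
  proof (rule block_sequence_exists[OF G(1) conv approx r(1), of "\<lambda>k. 1/5 * q ^ k" "\<lambda>k. p ^ k" d
        "\<lambda>k. 39/400/2000 * q ^ k"])
    show "r n \<le> 1/5 * q ^ 0" for n using r(2) by simp
  qed (use q_pos in \<open>auto simp: d_def p_def\<close>)
  have p_sums: "(\<lambda>i. p ^ k * p ^ i) sums (20 * p ^ k)" for k
    using sums_mult[OF geometric_sums[of p], of "p ^ k"] by (simp add: p_def mult.commute)
  have "summable (\<lambda>k. U (Suc k) - U k)"
    using size by (intro summable_comparison_test'[OF sums_summable[OF p_sums[of 0]]]) auto
  then have "(\<lambda>n. U 0 + (\<Sum>k<n. U (Suc k) - U k)) \<longlonglongrightarrow> U 0 + (\<Sum>k. U (Suc k) - U k)"
    by (intro tendsto_intros summable_LIMSEQ)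
  then obtain x where x: "U \<longlonglongrightarrow> x" by (simp add: sum_lessThan_telescope)
  have xG: "x \<in> G" by (rule closed_sequentially[OF G(2) UG x])
  define V where "V k = x - U k" for k
  have V_sums: "(\<lambda>i. U (Suc (i + k)) - U (i + k)) sums V k" for k
    using telescope_sums[OF LIMSEQ_ignore_initial_segment[OF x, of k]] by (simp add: V_def)
  have V_le: "norm (V k) \<le> 20" for k
  proof -
    have "norm (V k) \<le> 20 * p ^ k"
      by (rule norm_sums_le[OF V_sums p_sums]) (simp add: size power_add)
    also have "\<dots> \<le> 20" using power_le_one[of p k] by (simp add: p_def)
    finally show ?thesis .
  qed
  have x_le: "norm x \<le> 20" using V_le[of 0] by (simp add: V_def U0)
  have U_le: "norm (U k) \<le> 40" for k
    using norm_triangle_ineq4[of x "V k"] V_le[of k] x_le by (simp add: V_def)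
  have d_sums: "(\<lambda>i. 39/400/2000 * q ^ (i + k)) sums d k" for k
    using sums_mult[OF geometric_sums[of q], of "39/400/2000 * q ^ k"]
    by (simp add: q_def d_def power_add mult_ac)
  have m_mono: "m j \<le> m k" if "j \<le> k" for j k
    using strict_mono_less_eq[OF m] that by simp
  have V_early: "norm (V k - (T ^^ n) (V k)) \<le> d k" "norm (V k - (T' ^^ n) (V k)) \<le> d k" if n: "n \<le> m k" for k n
  proof -
    have "n \<le> m (i + k)" for i using n m_mono[of k "i + k"] by simp
    note e = early[OF this]
    show "norm (V k - (T ^^ n) (V k)) \<le> d k"
      by (rule norm_sums_le[OF sums_diff[OF V_sums bounded_linear.sums[OF T.bounded_linear_pow V_sums]] d_sums e(1)])
    show "norm (V k - (T' ^^ n) (V k)) \<le> d k"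
      by (rule norm_sums_le[OF sums_diff[OF V_sums bounded_linear.sums[OF T'.bounded_linear_pow V_sums]] d_sums e(2)])
  qed
  have CS: "\<bar>inner a b\<bar> \<le> s * t" if "norm a \<le> s" "norm b \<le> t" for a b :: 'a and s t
  proof -
    have "norm a * norm b \<le> s * t"
      using that order_trans[OF norm_ge_zero that(1)] by (intro mult_mono) auto
    then show ?thesis using Cauchy_Schwarz_ineq2[of a b] by linarith
  qed
  have d_pos: "d k > 0" for k by (simp add: d_def q_pos)
  have d_mono: "d k \<le> d j" if "j \<le> k" for j k
    using power_decreasing[OF that, of q] by (simp add: d_def q_def)
  \<comment> \<open>Partial sums and later tails are almost orthogonal: at time \<open>m k\<close>
    the vector \<open>U j\<close> has nearly vanished under \<open>T\<close>, while
    \<open>V k\<close> is nearly fixed by the adjoint.\<close>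
  have UV: "\<bar>inner (U j) (V k)\<bar> \<le> 60 * d j" if "j \<le> k" for j k
  proof -
    have "inner (U j) (V k) = inner ((T ^^ m k) (U j)) (V k) + inner (U j) (V k - (T' ^^ m k) (V k))"
      by (simp add: adjoint_pow inner_diff_right)
    moreover have "\<bar>inner ((T ^^ m k) (U j)) (V k)\<bar> \<le> d j * 20"
      by (intro CS late V_le m_mono that)
    moreover have "\<bar>inner (U j) (V k - (T' ^^ m k) (V k))\<bar> \<le> 40 * d k"
      by (intro CS U_le V_early) simp
    ultimately show ?thesis using d_mono[OF that] by linarith
  qed
  define w where "w k = U (Suc k) - U k" for k
  have w: "norm (w k) = p ^ k" "V k = w k + V (Suc k)" for k by (simp_all add: w_def V_def size)
  have w_le: "norm (w k) \<le> 1" for k using power_le_one[of p k] by (simp add: w p_def)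
  have wV: "\<bar>inner (w k) (V (Suc k))\<bar> \<le> 120 * d k" for k
    using UV[of k "Suc k"] UV[of "Suc k" "Suc k"] d_mono[of k "Suc k"]
    by (simp add: w_def inner_diff_left abs_le_iff)
  have ww: "inner (w k) (w k) = q ^ k" for k
    using w(1)[of k] by (simp add: q dot_square_norm power2_eq_square)
  \<comment> \<open>Approximate Pythagoras for \<open>V k = w k + V (Suc k)\<close>; the cross term
    enters twice.\<close>
  have V_rec: "inner (V k) (V k) \<ge> q ^ k + inner (V (Suc k)) (V (Suc k)) - 240 * d k" for k
    using wV[of k] by (simp add: w(2)[of k] inner_add_left inner_add_right inner_commute ww abs_le_iff)
  \<comment> \<open>Two applications of \<open>V_rec\<close> give
    \<open>(q + q\<^sup>2) * q ^ k\<close>, about 1.717 times \<open>q ^ k\<close>, less an error of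
    about 0.206 times \<open>q ^ k\<close>.\<close>
  have VV: "inner (V (Suc k)) (V (Suc k)) \<ge> 147/100 * q ^ k" for k
  proof -
    have "q ^ Suc k = 361/400 * q ^ k" "q ^ Suc (Suc k) = 361/400 * (361/400 * q ^ k)"
      by (simp_all add: q_def)
    then show ?thesis
      using V_rec[of "Suc k"] V_rec[of "Suc (Suc k)"] inner_ge_zero[of "V (Suc (Suc (Suc k)))"] q_pos[of k]
      unfolding d_def by linarith
  qed
  have "r n \<le> inner ((T ^^ n) x) x" for n
  proof -
    \<comment> \<open>In this time window \<open>U k\<close> has died out and
      \<open>V (Suc k)\<close> has barely moved; only the block \<open>w k\<close> is
      uncontrolled.\<close>
    obtain k where k: "m k \<le> n" "n < m (Suc k)"
    proof -
      define A where "A = {k. m k \<le> n}"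
      have fin: "finite A" unfolding A_def
        by (rule finite_subset[of _ "{..n}"]) (use strict_mono_imp_increasing[OF m] in \<open>auto intro: order_trans\<close>)
      have "A \<noteq> {}" using m0 by (auto simp: A_def intro: exI[of _ 0])
      with fin have "Max A \<in> A" by (rule Max_in)
      moreover have "Suc (Max A) \<notin> A" using Max_ge[OF fin] by (metis Suc_n_not_le_n)
      ultimately show ?thesis using that by (auto simp: A_def)
    qed
    define u v where "u = U k" and "v = V (Suc k)"
    define S where "S = (T ^^ n)"
    note S_lin = linear_add[OF T.linear_pow] linear_diff[OF T.linear_pow]
    have n: "n \<le> m (Suc k)" using k by simp
    have x_eq: "x = u + w k + v" by (simp add: u_def v_def w_def V_def)
    have "inner (S x) x = inner (S u) x + (inner (S (w k)) u + inner (S (w k)) (w k) + inner (S (w k)) v)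
        + (inner v v + inner (U (Suc k)) v - inner (v - S v) x)"
    proof -
      have "inner (S x) x = inner (S u) x + inner (S (w k)) x + inner (S v) x"
        unfolding S_def by (subst x_eq) (simp add: S_lin inner_add_left)
      moreover have "inner (S (w k)) x = inner (S (w k)) u + inner (S (w k)) (w k) + inner (S (w k)) v"
        by (subst x_eq) (simp add: inner_add_right)
      moreover have "inner (S v) x = inner v x - inner (v - S v) x" by (simp add: inner_diff_left)
      moreover have "inner v x = inner v v + inner (U (Suc k)) v"
        by (simp add: v_def V_def inner_diff_left inner_diff_right inner_commute)
      ultimately show ?thesis by linarith
    qed
    moreover have "\<bar>inner (S u) x\<bar> \<le> d k * 20"
      unfolding S_def u_def by (intro CS late k x_le)
    moreover have "\<bar>inner (S (w k)) u\<bar> \<le> 1 * d k"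
      unfolding S_def u_def adjoint_pow by (intro CS late k w_le)
    moreover have "\<bar>inner (S (w k)) (w k)\<bar> \<le> q ^ k"
      using CS[OF T.contraction_pow order_refl, of n "w k" "w k"] by (simp add: S_def w(1) q)
    moreover have "\<bar>inner (w k) (v - (T' ^^ n) v)\<bar> \<le> 1 * d (Suc k)"
      unfolding v_def by (intro CS w_le V_early n)
    then have "inner (S (w k)) v \<ge> inner (w k) v - d (Suc k)"
      unfolding S_def adjoint_pow by (simp add: inner_diff_right abs_le_iff)
    moreover have "\<bar>inner (v - S v) x\<bar> \<le> d (Suc k) * 20"
      unfolding v_def S_def by (intro CS V_early n x_le)
    moreover have "\<bar>inner (w k) v\<bar> \<le> 120 * d k" unfolding v_def by (rule wV)
    moreover have "\<bar>inner (U (Suc k)) v\<bar> \<le> 60 * d (Suc k)" unfolding v_def by (rule UV) simp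
    moreover have "inner v v \<ge> 147/100 * q ^ k" unfolding v_def by (rule VV)
    moreover have "d (Suc k) \<le> d k" by (rule d_mono) simp
    \<comment> \<open>The uncontrolled block costs at most \<open>q ^ k\<close> out of 147/100; the
      errors add up to 20 + 1 + 1 + 120 + 60 + 20 = 222 multiples of \<open>d k\<close>.\<close>
    ultimately have "inner (S x) x \<ge> 47/100 * q ^ k - 222 * d k" unfolding abs_le_iff by linarith
    also have "47/100 * q ^ k - 222 * d k \<ge> 1/5 * q ^ k" using q_pos[of k] by (simp add: d_def)
    finally show ?thesis using rU[OF k(1)] by (simp add: S_def)
  qed
  with xG show ?thesis by blast
qed

text \<open>Rescaling: with \<open>R\<close> a bound for the sequence, division by
  \<open>5 * R\<close> meets the threshold 1/5. The form is quadratic in \<open>x\<close>, hence the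
  square root in the witness.\<close>

theorem slow_orbit:
  fixes r :: "nat \<Rightarrow> real"
  assumes G: "subspace G" "closed G"
    and conv: "\<And>x. x \<in> G \<Longrightarrow> (\<lambda>n. (T ^^ n) x) \<longlonglongrightarrow> 0" "\<And>x. x \<in> G \<Longrightarrow> (\<lambda>n. (T' ^^ n) x) \<longlonglongrightarrow> 0"
    and approx: "\<And>e. e > 0 \<Longrightarrow> \<exists>x\<in>G. norm x = 1 \<and> norm (x - T x) \<le> e \<and> norm (x - T' x) \<le> e"
    and r: "r \<longlonglongrightarrow> 0"
  shows "\<exists>x\<in>G. \<forall>n. r n \<le> inner ((T ^^ n) x) x"
proof -
  obtain R where R: "R > 0" "\<And>n. norm (r n) \<le> R"
    using convergent_imp_Bseq[OF convergentI[OF r]] by (auto elim: BseqE)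
  have "(\<lambda>n. r n / (5 * R)) \<longlonglongrightarrow> 0" using tendsto_divide[OF r tendsto_const, of "5 * R"] R by simp
  moreover have "r n / (5 * R) \<le> 1/5" for n using R(1) R(2)[of n] by (simp add: field_simps)
  ultimately obtain x where x: "x \<in> G" "\<And>n. r n / (5 * R) \<le> inner ((T ^^ n) x) x"
    using slow_orbit_bounded[OF G conv approx, of "\<lambda>n. r n / (5 * R)"] by blast
  have "r n \<le> inner ((T ^^ n) (sqrt (5 * R) *\<^sub>R x)) (sqrt (5 * R) *\<^sub>R x)" for n
    using x(2)[of n] R(1) by (simp add: linear_scale[OF T.linear_pow] field_simps flip: mult.assoc)
  then show ?thesis using subspace_scale[OF G(1) x(1)] by blast
qed

end

subsection \<open>Pairs of orthogonal projections\<close>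

text \<open>Orthogonal projections appear here as symmetric idempotents for the real inner product;
  complex scalars enter only later.\<close>

locale projection_pair =
  fixes P1 P2 :: "'a::{real_inner,banach} \<Rightarrow> 'a"
  assumes lin1: "linear P1" and lin2: "linear P2"
    and sym1: "inner (P1 x) y = inner x (P1 y)" and sym2: "inner (P2 x) y = inner x (P2 y)"
    and idem1: "P1 (P1 x) = P1 x" and idem2: "P2 (P2 x) = P2 x"
begin

lemma orth1: "inner (P1 a) (b - P1 b) = 0" and orth2: "inner (P2 a) (b - P2 b) = 0"
  by (simp_all add: sym1 sym2 idem1 idem2 linear_diff[OF lin1] linear_diff[OF lin2])

lemma norm_split1: "(norm (P1 x))\<^sup>2 + (norm (x - P1 x))\<^sup>2 = (norm x)\<^sup>2"
  using orth1[of x x] by (simp add: power2_norm_eq_inner inner_diff_left inner_diff_right inner_commute)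

lemma norm_split2: "(norm (P2 x))\<^sup>2 + (norm (x - P2 x))\<^sup>2 = (norm x)\<^sup>2"
  using orth2[of x x] by (simp add: power2_norm_eq_inner inner_diff_left inner_diff_right inner_commute)

lemma norm_complement_le2: "norm (x - P2 x) \<le> norm x"
  by (rule power2_le_imp_le) (use norm_split2[of x] zero_le_power2[of "norm (P2 x)"] in \<open>linarith, simp\<close>)

definition DR :: "'a \<Rightarrow> 'a" where
  "DR x = P2 (P1 x) + ((x - P1 x) - P2 (x - P1 x))"

lemma DR_linear: "linear DR"
  unfolding DR_def
  by (intro linear_compose_add linear_compose_sub linear_ident lin1 lin2
      linear_compose[OF lin1 lin2, unfolded o_def]
      linear_compose[OF linear_compose_sub[OF linear_ident lin1] lin2, unfolded o_def])

lemma DR_defect: "x - DR x = (P1 x - P2 (P1 x)) + P2 (x - P1 x)"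
  by (simp add: DR_def)

lemma norm_orth_sum: "(norm (P2 a + (b - P2 b)))\<^sup>2 = (norm (P2 a))\<^sup>2 + (norm (b - P2 b))\<^sup>2"
  using orth2[of a b] unfolding power2_norm_eq_inner inner_add_left inner_add_right
  by (simp add: inner_commute)

text \<open>Splitting \<open>x\<close> by \<open>P1\<close> and both halves by \<open>P2\<close>
  gives four pieces whose squared norms add up to that of \<open>x\<close>; \<open>DR x\<close> and
  the defect each consist of two of them, orthogonal to each other.\<close>

lemma DR_pythagoras: "(norm (DR x))\<^sup>2 + (norm (x - DR x))\<^sup>2 = (norm x)\<^sup>2"
  unfolding DR_defect
  unfolding DR_def norm_orth_sum add.commute[of "P1 x - P2 (P1 x)"]
  using norm_split2[of "P1 x"] norm_split2[of "x - P1 x"] norm_split1[of x] by linarith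

text \<open>The difference of the projections consists of the same two orthogonal pieces as the
  defect, one with opposite sign.\<close>

lemma norm_difference:
  "(norm (P1 x - P2 x))\<^sup>2 = (norm (P1 x - P2 (P1 x)))\<^sup>2 + (norm (P2 (x - P1 x)))\<^sup>2"
proof -
  have eq: "P1 x - P2 x = P2 (- (x - P1 x)) + (P1 x - P2 (P1 x))"
    unfolding linear_neg[OF lin2] linear_diff[OF lin2] by simp
  show ?thesis
    unfolding eq unfolding norm_orth_sum by (simp only: linear_neg[OF lin2] norm_minus_cancel add.commute)
qed

text \<open>Exchanging the projections only changes a sign on the right, so \<open>DR\<close> and
  its adjoint have equal defect norms and the same fixed vectors.\<close>

lemma norm_DR_defect: "norm (x - DR x) = norm (P1 x - P2 x)"
proof (rule power2_eq_imp_eq)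
  show "(norm (x - DR x))\<^sup>2 = (norm (P1 x - P2 x))\<^sup>2"
    unfolding DR_defect norm_difference add.commute[of "P1 x - P2 (P1 x)"] norm_orth_sum by simp
qed simp_all

lemma DR_fixed_iff: "DR x = x \<longleftrightarrow> P1 x = P2 x"
  using norm_DR_defect[of x] by (metis norm_eq_zero right_minus_eq)

sublocale averaged_isometry DR
  by (rule averaged_isometry.intro[OF DR_linear DR_pythagoras])

end

text \<open>Both orders of the pair are kept under the prefixes \<open>A\<close> and
  \<open>B\<close>; the exchanged order provides the adjoint.\<close>

locale projection_pair_both = A: projection_pair P1 P2 for P1 P2 :: "'a::{real_inner,banach} \<Rightarrow> 'a"
begin

sublocale B: projection_pair P2 P1
  by (rule projection_pair.intro[OF A.lin2 A.lin1 A.sym2 A.sym1 A.idem2 A.idem1])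

lemma DR_adjoint: "inner (A.DR u) v = inner u (B.DR v)"
  unfolding A.DR_def B.DR_def
  by (simp add: inner_add_left inner_add_right inner_diff_left inner_diff_right A.sym1 A.sym2
      linear_diff[OF A.lin1] linear_diff[OF A.lin2])

sublocale adjoint_averaged_isometries A.DR B.DR
  by unfold_locales (rule DR_adjoint)

end

subsection \<open>Complex Hilbert spaces\<close>

lemma cinner_zero_left [simp]: "cinner 0 x = 0"
  using cinner_add_left[of 0 0 x] by simp

lemma cinner_scaleC_right: "cinner x (c *\<^sub>C y) = cnj c * cinner x y"
  by (metis cinner_commute cinner_scaleC_left complex_cnj_mult)

lemma Im_cinner_self: "Im (cinner x x) = 0"
  using arg_cong[OF cinner_commute[of x x], of Im] by simp

lemma norm_scaleC: "norm (c *\<^sub>C x) = cmod c * norm (x :: 'a::complex_inner)"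
proof (rule power2_eq_imp_eq)
  have "(norm (c *\<^sub>C x))\<^sup>2 = Re ((c * cnj c) * cinner x x)"
    by (simp add: power2_norm_eq_inner inner_eq_Re_cinner cinner_scaleC_left cinner_scaleC_right Im_cinner_self algebra_simps)
  also have "\<dots> = (cmod c)\<^sup>2 * (norm x)\<^sup>2"
    by (simp add: complex_mult_cnj cmod_power2 power2_norm_eq_inner inner_eq_Re_cinner)
  finally show "(norm (c *\<^sub>C x))\<^sup>2 = (cmod c * norm x)\<^sup>2" by (simp add: power_mult_distrib)
qed simp_all

lemma Im_cinner: "Im (cinner x y) = - inner (\<i> *\<^sub>C x) y"
  by (simp add: inner_eq_Re_cinner cinner_scaleC_left)

text \<open>Provides the functional for weak slowness. Real Cauchy-Schwarz is applied to real and
  imaginary part separately, whence the factor 2.\<close>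

lemma cinner_left_in_cdual: "(\<lambda>u. cinner u y) \<in> cdual"
proof -
  have "cmod (cinner u y) \<le> norm u * (2 * norm y)" for u
  proof -
    have "cmod (cinner u y) \<le> \<bar>inner u y\<bar> + \<bar>inner (\<i> *\<^sub>C u) y\<bar>"
      using cmod_le[of "cinner u y"] by (simp add: Im_cinner inner_eq_Re_cinner)
    also have "\<dots> \<le> norm u * norm y + norm (\<i> *\<^sub>C u) * norm y"
      by (intro add_mono Cauchy_Schwarz_ineq2)
    finally show ?thesis by (simp add: norm_scaleC)
  qed
  then have "bounded_linear (\<lambda>u. cinner u y)"
    by (intro bounded_linear_intro) (auto simp: cinner_add_left scaleR_eq_scaleC cinner_scaleC_left scaleR_conv_of_real)
  then show ?thesis by (simp add: cdual_def cinner_scaleC_left)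
qed

lemma csubspace_imp_subspace: "csubspace M \<Longrightarrow> subspace M"
  by (auto simp: csubspace_def subspace_def scaleR_eq_scaleC)

text \<open>Testing against \<open>\<i> *\<^sub>C y\<close> recovers the imaginary part, so for
  complex subspaces real orthogonality suffices and the real theory applies.\<close>

lemma mem_ocomp_iff: "csubspace M \<Longrightarrow> x \<in> ocomp M \<longleftrightarrow> (\<forall>y\<in>M. inner x y = 0)"
proof
  assume M: "csubspace M" and x: "\<forall>y\<in>M. inner x y = 0"
  have "cinner x y = 0" if y: "y \<in> M" for y
  proof (rule complex_eqI)
    have "inner x (\<i> *\<^sub>C y) = 0" using M x y by (auto simp: csubspace_def)
    then show "Im (cinner x y) = Im 0" by (simp add: inner_eq_Re_cinner cinner_scaleC_right)
  qed (use x y in \<open>simp add: inner_eq_Re_cinner[symmetric]\<close>)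
  then show "x \<in> ocomp M" by (simp add: ocomp_def)
qed (simp add: ocomp_def inner_eq_Re_cinner)

lemma csubspace_ocomp: "csubspace (ocomp M)"
  by (simp add: csubspace_def ocomp_def cinner_add_left cinner_scaleC_left)

lemma csubspace_Int: "csubspace M \<Longrightarrow> csubspace N \<Longrightarrow> csubspace (M \<inter> N)"
  by (simp add: csubspace_def)

lemma scaleC_diff_right: "c *\<^sub>C (x - y) = c *\<^sub>C x - c *\<^sub>C (y :: 'a::complex_vector)"
  by (metis scaleC_add_right add_diff_cancel_right' diff_add_cancel)

lemma closed_ocomp: "csubspace M \<Longrightarrow> closed (ocomp M)"
proof -
  assume M: "csubspace M"
  have "ocomp M = (\<Inter>y\<in>M. {x. inner x y = 0})" using mem_ocomp_iff[OF M] by auto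
  then show ?thesis by (auto intro!: closed_INT closed_Collect_eq continuous_intros)
qed

lemma csubspace_set_plus: "csubspace M \<Longrightarrow> csubspace N \<Longrightarrow> csubspace (M + N)"
  unfolding csubspace_def
proof (intro conjI allI ballI)
  assume MN: "0 \<in> M \<and> (\<forall>x\<in>M. \<forall>y\<in>M. x + y \<in> M) \<and> (\<forall>c. \<forall>x\<in>M. c *\<^sub>C x \<in> M)"
    "0 \<in> N \<and> (\<forall>x\<in>N. \<forall>y\<in>N. x + y \<in> N) \<and> (\<forall>c. \<forall>x\<in>N. c *\<^sub>C x \<in> N)"
  show "0 \<in> M + N" using MN set_plus_intro[of 0 M 0 N] by simp
  fix x assume "x \<in> M + N"
  then obtain a b where x: "x = a + b" "a \<in> M" "b \<in> N" by (rule set_plus_elim)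
  show "c *\<^sub>C x \<in> M + N" for c unfolding x scaleC_add_right using MN x by (intro set_plus_intro) auto
  fix y assume "y \<in> M + N"
  then obtain a' b' where y: "y = a' + b'" "a' \<in> M" "b' \<in> N" by (rule set_plus_elim)
  have "(a + a') + (b + b') \<in> M + N" using MN x y by (intro set_plus_intro) auto
  then show "x + y \<in> M + N" by (simp add: x y ac_simps)
qed

section \<open>Orthogonal projections onto closed complex subspaces\<close>

context
  fixes M :: "'a::complex_hilbert set"
  assumes M: "csubspace M" and cl: "closed M"
begin

lemma oproj_eqI:
  assumes "y \<in> M" "\<And>z. z \<in> M \<Longrightarrow> inner (x - y) z = 0"
  shows "oproj M x = y"
  unfolding oproj_def
proof (rule the_equality)
  show "y \<in> M \<and> x - y \<in> ocomp M" using assms by (simp add: mem_ocomp_iff[OF M])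
  fix w assume w: "w \<in> M \<and> x - w \<in> ocomp M"
  have "w - y \<in> M" using w assms(1) by (intro subspace_diff csubspace_imp_subspace[OF M]) auto
  then have "inner (x - y) (w - y) = 0" "inner (x - w) (w - y) = 0"
    using assms(2) w by (auto simp: mem_ocomp_iff[OF M])
  then have "inner (w - y) (w - y) = 0" by (simp add: inner_diff_left)
  then show "w = y" by simp
qed

lemma oproj_mem: "oproj M x \<in> M" and oproj_orth: "z \<in> M \<Longrightarrow> inner (x - oproj M x) z = 0"
proof -
  obtain y where "y \<in> M" "\<And>z. z \<in> M \<Longrightarrow> inner (x - y) z = 0"
    using orthogonal_projection_exists[OF csubspace_imp_subspace[OF M] cl, of x] by blast
  with oproj_eqI[OF this] show "oproj M x \<in> M" "z \<in> M \<Longrightarrow> inner (x - oproj M x) z = 0" by auto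
qed

lemma oproj_linear: "linear (oproj M)"
proof (rule linearI)
  note sub = csubspace_imp_subspace[OF M]
  fix x y :: 'a and c :: real
  show "oproj M (x + y) = oproj M x + oproj M y"
    using oproj_orth[of _ x] oproj_orth[of _ y]
    by (intro oproj_eqI subspace_add sub oproj_mem) (simp add: inner_add_left inner_diff_left)
  show "oproj M (c *\<^sub>R x) = c *\<^sub>R oproj M x"
    using oproj_orth[of _ x]
    by (intro oproj_eqI subspace_mul sub oproj_mem) (simp add: inner_diff_left)
qed

lemma oproj_scaleC: "oproj M (c *\<^sub>C x) = c *\<^sub>C oproj M x"
proof (rule oproj_eqI)
  show "c *\<^sub>C oproj M x \<in> M" using M oproj_mem by (simp add: csubspace_def)
  fix z assume "z \<in> M"
  have "x - oproj M x \<in> ocomp M" using oproj_orth by (simp add: mem_ocomp_iff[OF M])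
  then have "c *\<^sub>C (x - oproj M x) \<in> ocomp M" using csubspace_ocomp[of M] unfolding csubspace_def by blast
  then show "inner (c *\<^sub>C x - c *\<^sub>C oproj M x) z = 0"
    using \<open>z \<in> M\<close> by (simp add: mem_ocomp_iff[OF M] scaleC_diff_right)
qed

lemma oproj_sym: "inner (oproj M x) y = inner x (oproj M y)"
  using oproj_orth[OF oproj_mem, of x y] oproj_orth[OF oproj_mem, of y x]
  by (simp add: inner_diff_left inner_diff_right inner_commute)

lemma oproj_bounded_linear: "bounded_linear (oproj M)"
proof (rule bounded_linear_intro)
  fix x
  have "(norm (oproj M x))\<^sup>2 = inner x (oproj M x)"
    using oproj_orth[OF oproj_mem, of x x] by (simp add: power2_norm_eq_inner inner_diff_left)
  then have "norm (oproj M x) * norm (oproj M x) \<le> norm (oproj M x) * norm x"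
    using norm_cauchy_schwarz[of x "oproj M x"] by (simp add: power2_eq_square mult.commute)
  then show "norm (oproj M x) \<le> norm x * 1" by (cases "oproj M x = 0") auto
qed (simp_all add: linear_add[OF oproj_linear] linear_scale[OF oproj_linear])

lemma oproj_id: "x \<in> M \<Longrightarrow> oproj M x = x"
  by (rule oproj_eqI) auto

lemma mem_ocomp_iff_oproj: "x \<in> ocomp M \<longleftrightarrow> oproj M x = 0"
proof
  assume "x \<in> ocomp M"
  then show "oproj M x = 0"
    using subspace_0[OF csubspace_imp_subspace[OF M]] by (intro oproj_eqI) (auto simp: mem_ocomp_iff[OF M])
next
  assume "oproj M x = 0"
  then show "x \<in> ocomp M" using oproj_orth[of _ x] by (simp add: mem_ocomp_iff[OF M])
qed

end

subsection \<open>Douglas-Rachford operators\<close>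

locale closed_subspace_pair =
  fixes M1 M2 :: "'a::complex_hilbert set"
  assumes M1: "csubspace M1" "closed M1" and M2: "csubspace M2" "closed M2"
begin

abbreviation "P1 \<equiv> oproj M1"
abbreviation "P2 \<equiv> oproj M2"
abbreviation "T \<equiv> douglas_rachford M1 M2"

definition F :: "'a set" where
  "F = (M1 \<inter> M2) + (ocomp M1 \<inter> ocomp M2)"

sublocale projection_pair_both P1 P2
  by (intro projection_pair_both.intro projection_pair.intro oproj_linear oproj_sym oproj_id oproj_mem M1 M2)

lemma A_DR_eq: "A.DR = T"
  by (auto simp: A.DR_def douglas_rachford_def)

text \<open>If the projections of \<open>x\<close> agree, their common value lies in both subspaces
  and both projections annihilate the remainder. This identifies \<open>F\<close> with the fixed
  space.\<close>

lemma mem_F_iff: "x \<in> F \<longleftrightarrow> P1 x = P2 x"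
proof
  assume "x \<in> F"
  then obtain a b where "x = a + b" "a \<in> M1" "a \<in> M2" "b \<in> ocomp M1" "b \<in> ocomp M2"
    unfolding F_def by (auto elim: set_plus_elim)
  then show "P1 x = P2 x"
    using M1 M2 by (simp add: linear_add[OF A.lin1] linear_add[OF A.lin2] oproj_id mem_ocomp_iff_oproj)
next
  assume eq: "P1 x = P2 x"
  have "P1 x \<in> M1 \<inter> M2" using oproj_mem[OF M1, of x] oproj_mem[OF M2, of x] eq by simp
  moreover have "P2 (P1 x) = P2 x" by (simp add: eq A.idem2)
  then have "x - P1 x \<in> ocomp M1 \<inter> ocomp M2"
    by (simp add: mem_ocomp_iff_oproj[OF M1] mem_ocomp_iff_oproj[OF M2] linear_diff[OF A.lin1]
        linear_diff[OF A.lin2] A.idem1)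
  ultimately have "P1 x + (x - P1 x) \<in> F" unfolding F_def by (rule set_plus_intro)
  then show "x \<in> F" by simp
qed

lemma csubspace_F: "csubspace F"
  unfolding F_def by (intro csubspace_set_plus csubspace_Int csubspace_ocomp M1 M2)

lemma closed_F: "closed F"
proof -
  have "F = {x. P1 x = P2 x}" using mem_F_iff by auto
  then show ?thesis by (simp add: closed_Collect_eq linear_continuous_on oproj_bounded_linear M1 M2)
qed

section \<open>Reduction to the orthogonal complement of the fixed space\<close>

abbreviation "P \<equiv> oproj F"
abbreviation "G \<equiv> ocomp F"

lemma mem_G_iff: "x \<in> G \<longleftrightarrow> (\<forall>z\<in>F. inner x z = 0)"
  by (rule mem_ocomp_iff[OF csubspace_F])

lemma T_fixed_iff: "T z = z \<longleftrightarrow> z \<in> F" and T'_fixed_iff: "B.DR z = z \<longleftrightarrow> z \<in> F"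
  using A.DR_fixed_iff[of z] B.DR_fixed_iff[of z] by (auto simp: A_DR_eq mem_F_iff)

lemma pow_G_tendsto_0:
  assumes "x \<in> G"
  shows "(\<lambda>n. (T ^^ n) x) \<longlonglongrightarrow> 0" "(\<lambda>n. (B.DR ^^ n) x) \<longlonglongrightarrow> 0"
proof -
  show "(\<lambda>n. (T ^^ n) x) \<longlonglongrightarrow> 0" unfolding A_DR_eq[symmetric]
    by (rule A.pow_tendsto_0[of B.DR])
      (use assms in \<open>auto simp: DR_adjoint T'_fixed_iff mem_G_iff\<close>)
  show "(\<lambda>n. (B.DR ^^ n) x) \<longlonglongrightarrow> 0"
  proof (rule B.pow_tendsto_0[of A.DR])
    show "inner (B.DR u) v = inner u (A.DR v)" for u v
      using DR_adjoint[of v u] by (simp add: inner_commute)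
  qed (use assms in \<open>auto simp: A_DR_eq T_fixed_iff mem_G_iff\<close>)
qed

lemma pow_fixed: "z \<in> F \<Longrightarrow> (T ^^ n) z = z"
  using T_fixed_iff[of z] by (induction n) auto

lemma complement_in_G: "x - P x \<in> G"
  using oproj_orth[OF csubspace_F closed_F, of _ x] by (simp add: mem_G_iff)

lemmas T_pow_linear = A.linear_pow[unfolded A_DR_eq]

text \<open>\<open>P x\<close> is fixed by \<open>T\<close>, so all rates are rates of orbits in
  \<open>G\<close>.\<close>

lemma pow_minus_P: "(T ^^ n) x - P x = (T ^^ n) (x - P x)"
  using pow_fixed[OF oproj_mem[OF csubspace_F closed_F, of x], of n]
  by (simp add: linear_diff[OF T_pow_linear])

lemma P_eq_0: "x \<in> G \<Longrightarrow> P x = 0"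
  using mem_ocomp_iff_oproj[OF csubspace_F closed_F] by blast

lemma strong_convergence: "(\<lambda>n. (T ^^ n) x - P x) \<longlonglongrightarrow> 0"
  unfolding pow_minus_P by (rule pow_G_tendsto_0[OF complement_in_G])

section \<open>Closedness of the sum, lower bounds and rates of convergence\<close>

lemma M_in_F:
  assumes "z \<in> M1" "z \<in> M2" shows "z \<in> F"
  using assms by (simp add: mem_F_iff oproj_id M1 M2)

lemma ocomp_in_F:
  assumes "z \<in> ocomp M1" "z \<in> ocomp M2" shows "z \<in> F"
  using assms by (simp add: mem_F_iff mem_ocomp_iff_oproj M1 M2)

lemmas sub1 = csubspace_imp_subspace[OF M1(1)]
lemmas sub2 = csubspace_imp_subspace[OF M2(1)]

text \<open>The two pieces of \<open>P1 x - P2 x\<close> control \<open>P1 x\<close> and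
  \<open>x - P1 x\<close> separately; both estimates come from bounded decompositions in
  \<open>M1 + M2\<close>.\<close>

lemma difference_bounded_below:
  assumes cl: "closed (M1 + M2)"
  shows "\<exists>K>0. \<forall>x\<in>G. norm x \<le> K * norm (P1 x - P2 x)"
proof -
  obtain K where K: "K > 0" and dec: "\<And>z. z \<in> M1 + M2 \<Longrightarrow> \<exists>a\<in>M1. \<exists>b\<in>M2. z = a + b \<and>
      norm a \<le> K * norm z \<and> norm b \<le> K * norm z"
    using closed_sum_bounded_decomposition[OF sub1 sub2 M1(2) M2(2) cl] by blast
  have cancel: "norm x \<le> K * t" if "(norm x)\<^sup>2 \<le> norm x * (K * t)" "t \<ge> 0" for x :: 'a and t
    using that K by (cases "x = 0") (auto simp: power2_eq_square)
  \<comment> \<open>Decomposing \<open>a - P2 a\<close> as \<open>a' + b'\<close> puts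
    \<open>a - a'\<close> into both subspaces, so \<open>a\<close> is orthogonal to it and
    \<open>a'\<close> can replace one factor in \<open>inner a a\<close>.\<close>
  have part1: "norm a \<le> K * norm (a - P2 a)"
    if a: "a \<in> M1" and orth: "\<And>z. z \<in> M1 \<inter> M2 \<Longrightarrow> inner a z = 0" for a
  proof -
    have "a + (- P2 a) \<in> M1 + M2"
      using a oproj_mem[OF M2] by (intro set_plus_intro subspace_neg sub2)
    then obtain a' b' where ab: "a' \<in> M1" "b' \<in> M2" "a - P2 a = a' + b'" "norm a' \<le> K * norm (a - P2 a)"
      using dec[of "a - P2 a"] by auto
    have "a - a' = P2 a + b'" using ab(3) by (simp add: algebra_simps)
    then have "a - a' \<in> M1 \<inter> M2"
      using subspace_diff[OF sub1 a ab(1)] subspace_add[OF sub2 oproj_mem[OF M2] ab(2)] by simp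
    then have "inner a (a - a') = 0" by (rule orth)
    then have "(norm a)\<^sup>2 = inner a a'" by (simp add: power2_norm_eq_inner inner_diff_right)
    also have "\<dots> \<le> norm a * (K * norm (a - P2 a))"
      using norm_cauchy_schwarz[of a a'] mult_left_mono[OF ab(4), of "norm a"] by simp
    finally show ?thesis by (rule cancel) simp
  qed
  \<comment> \<open>The component of \<open>b\<close> off the closed sum lies in both complements
    and so vanishes. Decomposing \<open>b\<close> itself, the \<open>M1\<close> part is orthogonal
    to \<open>b\<close> and the \<open>M2\<close> part sees only \<open>P2 b\<close>.\<close>
  have part2: "norm b \<le> K * norm (P2 b)"
    if b: "b \<in> ocomp M1" and orth: "\<And>z. z \<in> ocomp M1 \<inter> ocomp M2 \<Longrightarrow> inner b z = 0" for b
  proof -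
    define Z where "Z = M1 + M2"
    have Z: "csubspace Z" "closed Z" unfolding Z_def by (intro csubspace_set_plus M1 M2, rule cl)
    have sub: "M1 \<subseteq> Z" "M2 \<subseteq> Z"
      using subspace_0[OF sub1] subspace_0[OF sub2] set_plus_intro[of _ M1 0 M2] set_plus_intro[of 0 M1 _ M2]
      by (auto simp: Z_def)
    have "b - oproj Z b \<in> ocomp Z" using oproj_orth[OF Z] by (simp add: mem_ocomp_iff[OF Z(1)])
    then have "b - oproj Z b \<in> ocomp M1 \<inter> ocomp M2" using sub by (auto simp: ocomp_def)
    then have "inner b (b - oproj Z b) = 0" by (rule orth)
    moreover have "inner (b - oproj Z b) (oproj Z b) = 0" by (intro oproj_orth Z oproj_mem)
    ultimately have "inner (b - oproj Z b) (b - oproj Z b) = 0"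
      by (simp add: inner_diff_left inner_diff_right inner_commute)
    then have "b \<in> M1 + M2" using oproj_mem[OF Z, of b] by (simp add: Z_def)
    then obtain m1 m2 where m: "m1 \<in> M1" "m2 \<in> M2" "b = m1 + m2" "norm m2 \<le> K * norm b"
      using dec by blast
    have "inner b m1 = 0" using b m(1) by (simp add: mem_ocomp_iff[OF M1(1)])
    then have "(norm b)\<^sup>2 = inner b m2"
      using m(3) by (metis add_0 inner_add_right power2_norm_eq_inner)
    also have "\<dots> = inner (P2 b) m2" using oproj_orth[OF M2 m(2), of b] by (simp add: inner_diff_left)
    also have "\<dots> \<le> norm b * (K * norm (P2 b))"
      using norm_cauchy_schwarz[of "P2 b" m2] mult_left_mono[OF m(4), of "norm (P2 b)"] by (simp add: mult_ac)
    finally show ?thesis by (rule cancel) simp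
  qed
  have "norm x \<le> K * norm (P1 x - P2 x)" if x: "x \<in> G" for x
  proof (rule power2_le_imp_le)
    have "inner (P1 x) z = 0" if z: "z \<in> M1 \<inter> M2" for z
      using x z M_in_F[of z] by (simp add: oproj_sym[OF M1] oproj_id[OF M1] mem_G_iff)
    then have 1: "norm (P1 x) \<le> K * norm (P1 x - P2 (P1 x))" by (intro part1 oproj_mem M1) auto
    have "inner (x - P1 x) z = 0" if z: "z \<in> ocomp M1 \<inter> ocomp M2" for z
      using x z ocomp_in_F[of z] by (simp add: inner_diff_left oproj_sym[OF M1] mem_ocomp_iff_oproj[OF M1] mem_G_iff)
    then have 2: "norm (x - P1 x) \<le> K * norm (P2 (x - P1 x))"
      by (intro part2) (auto simp: mem_ocomp_iff_oproj[OF M1] linear_diff[OF A.lin1] A.idem1)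
    have "(norm x)\<^sup>2 = (norm (P1 x))\<^sup>2 + (norm (x - P1 x))\<^sup>2" by (simp add: A.norm_split1)
    also have "\<dots> \<le> (K * norm (P1 x - P2 (P1 x)))\<^sup>2 + (K * norm (P2 (x - P1 x)))\<^sup>2"
      by (intro add_mono power_mono 1 2) simp_all
    also have "\<dots> = (K * norm (P1 x - P2 x))\<^sup>2"
      by (simp add: A.norm_difference power_mult_distrib distrib_left)
    finally show "(norm x)\<^sup>2 \<le> (K * norm (P1 x - P2 x))\<^sup>2" .
  qed (use K in simp)
  with K show ?thesis by blast
qed

lemma T_G: "x \<in> G \<Longrightarrow> T x \<in> G"
  unfolding mem_G_iff A_DR_eq[symmetric] DR_adjoint by (simp add: T'_fixed_iff[THEN iffD2])

text \<open>By the Pythagorean identity a lower bound for the defect on \<open>G\<close> makes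
  \<open>T\<close> a strict contraction there.\<close>

lemma exponential_convergence:
  assumes "closed (M1 + M2)"
  shows "\<exists>r\<in>{0..<1}. \<forall>n. onorm (\<lambda>x. (T ^^ n) x - P x) \<le> r ^ n"
proof -
  obtain K where K: "K > 0" "\<And>x. x \<in> G \<Longrightarrow> norm x \<le> K * norm (P1 x - P2 x)"
    using difference_bounded_below[OF assms] by blast
  \<comment> \<open>Using \<open>K + 1\<close> in place of \<open>K\<close> ensures that the
    radicand is positive.\<close>
  define r where "r = sqrt (1 - 1 / (K + 1)\<^sup>2)"
  have "(K + 1)\<^sup>2 > 1" using K by (simp add: power2_eq_square algebra_simps add_pos_pos)
  then have "1 / (K + 1)\<^sup>2 < 1" "1 / (K + 1)\<^sup>2 > 0"
    using K(1) by (simp_all add: divide_less_eq_1 less_1_mult)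
  then have r: "r \<ge> 0" "r < 1" "r\<^sup>2 = 1 - 1 / (K + 1)\<^sup>2"
    unfolding r_def by (auto simp del: zero_less_divide_1_iff divide_less_eq_1)
  have step: "norm (T x) \<le> r * norm x" if x: "x \<in> G" for x
  proof (rule power2_le_imp_le)
    have "norm x \<le> (K + 1) * norm (P1 x - P2 x)"
      using K(2)[OF x] by (simp add: distrib_right add_increasing2)
    then have "norm x / (K + 1) \<le> norm (P1 x - P2 x)" using K(1) by (simp add: field_simps)
    then have "(norm x / (K + 1))\<^sup>2 \<le> (norm (P1 x - P2 x))\<^sup>2"
      using K(1) by (intro power_mono) auto
    then have "(norm (T x))\<^sup>2 \<le> (norm x)\<^sup>2 - (norm x / (K + 1))\<^sup>2"
      using A.DR_pythagoras[of x] unfolding A.norm_DR_defect unfolding A_DR_eq by linarith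
    also have "\<dots> = (r * norm x)\<^sup>2" by (simp add: power_mult_distrib r(3) power_divide left_diff_distrib)
    finally show "(norm (T x))\<^sup>2 \<le> (r * norm x)\<^sup>2" .
  qed (use r in simp)
  have pow: "(T ^^ n) x \<in> G \<and> norm ((T ^^ n) x) \<le> r ^ n * norm x" if x: "x \<in> G" for n x
  proof (induction n)
    case (Suc n)
    then have "norm ((T ^^ Suc n) x) \<le> r * (r ^ n * norm x)"
      using step[of "(T ^^ n) x"] mult_left_mono[of "norm ((T ^^ n) x)" _ r] r(1) by force
    then show ?case using Suc T_G by simp
  qed (simp add: x)
  have "norm (x - P x) \<le> norm x" for x
  proof (rule power2_le_imp_le)
    have "inner (x - P x) (P x) = 0" by (intro oproj_orth oproj_mem csubspace_F closed_F)
    then have "(norm x)\<^sup>2 = (norm (x - P x))\<^sup>2 + (norm (P x))\<^sup>2"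
      by (simp add: power2_norm_eq_inner inner_diff_left inner_diff_right inner_commute)
    then show "(norm (x - P x))\<^sup>2 \<le> (norm x)\<^sup>2" by simp
  qed simp
  then have "norm ((T ^^ n) x - P x) \<le> r ^ n * norm x" for n x
    using pow[OF complement_in_G, of n x] mult_left_mono[of "norm (x - P x)" "norm x" "r ^ n"] r(1)
    unfolding pow_minus_P by force
  then have "onorm (\<lambda>x. (T ^^ n) x - P x) \<le> r ^ n" for n
    using r(1) by (intro onorm_bound) auto
  then show ?thesis using r by (intro bexI[of _ r]) auto
qed

text \<open>Convergent sums are normalised so that differences of their \<open>M1\<close> parts lie
  in \<open>G\<close>; the lower bound then makes these parts Cauchy, and the \<open>M2\<close>
  parts converge with them.\<close>

lemma closed_sum:
  assumes e: "e > 0" and below: "\<And>x. x \<in> G \<Longrightarrow> e * norm x \<le> norm (P1 x - P2 x)"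
  shows "closed (M1 + M2)"
proof (rule closed_sequential_limits[THEN iffD2], safe)
  fix f z assume f: "\<forall>n. f n \<in> M1 + M2" and z: "f \<longlonglongrightarrow> z"
  define I where "I = M1 \<inter> M2"
  have I: "csubspace I" "closed I" unfolding I_def using M1 M2 by (auto intro: csubspace_Int)
  \<comment> \<open>The component of \<open>a\<close> in the intersection is moved to
    \<open>b\<close>.\<close>
  have "\<exists>a b. a \<in> M1 \<inter> ocomp I \<and> b \<in> M2 \<and> f n = a + b" for n
  proof -
    obtain a b where ab: "a \<in> M1" "b \<in> M2" "f n = a + b" using f set_plus_elim by metis
    have "oproj I a \<in> M1" "oproj I a \<in> M2" using oproj_mem[OF I, of a] by (auto simp: I_def)
    moreover have "a - oproj I a \<in> ocomp I" using oproj_orth[OF I] by (simp add: mem_ocomp_iff[OF I(1)])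
    moreover have "f n = (a - oproj I a) + (b + oproj I a)" using ab by simp
    ultimately show ?thesis using ab subspace_diff[OF sub1] subspace_add[OF sub2] by blast
  qed
  then obtain a b where a: "\<And>n. a n \<in> M1" "\<And>n. a n \<in> ocomp I" and b: "\<And>n. b n \<in> M2"
    and fab: "\<And>n. f n = a n + b n" by (metis IntD1 IntD2)
  have "Cauchy f" using z by (rule LIMSEQ_imp_Cauchy)
  have est: "e * norm (a m - a n) \<le> norm (f m - f n)" for m n
  proof -
    define c where "c = a m - a n"
    have c: "c \<in> M1" "c \<in> ocomp I"
      using subspace_diff[OF sub1 a(1) a(1)] subspace_diff[OF csubspace_imp_subspace[OF csubspace_ocomp] a(2) a(2)]
      by (auto simp: c_def)
    have "inner c z = 0" if "z \<in> F" for z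
    proof -
      obtain u v where uv: "z = u + v" "u \<in> I" "v \<in> ocomp M1"
        using \<open>z \<in> F\<close> unfolding F_def I_def by (auto elim: set_plus_elim)
      have "inner v c = 0" using uv(3) c(1) by (simp add: mem_ocomp_iff[OF M1(1)])
      moreover have "inner c u = 0" using uv(2) c(2) by (simp add: mem_ocomp_iff[OF I(1)])
      ultimately show ?thesis by (simp add: uv(1) inner_add_right inner_commute)
    qed
    then have "e * norm c \<le> norm (c - P2 c)"
      using below[of c] c(1) by (simp add: mem_G_iff oproj_id[OF M1])
    \<comment> \<open>The \<open>M2\<close> parts are fixed by \<open>P2\<close>, so they
      cancel.\<close>
    also have "c - P2 c = (f m - f n) - P2 (f m - f n)"
      by (simp add: c_def fab linear_add[OF A.lin2] linear_diff[OF A.lin2] oproj_id[OF M2 b])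
    also have "norm \<dots> \<le> norm (f m - f n)"
      by (rule A.norm_complement_le2)
    finally show ?thesis by (simp add: c_def)
  qed
  have "Cauchy a"
  proof (rule CauchyI)
    fix d :: real assume d: "d > 0"
    then have "e * d > 0" using e by simp
    then obtain N where N: "\<And>m n. m \<ge> N \<Longrightarrow> n \<ge> N \<Longrightarrow> norm (f m - f n) < e * d"
      using CauchyD[OF \<open>Cauchy f\<close>] by blast
    have "norm (a m - a n) < d" if "m \<ge> N" "n \<ge> N" for m n
      using N[OF that] est[of m n] e mult_less_cancel_left_pos[OF e, of "norm (a m - a n)" d] by linarith
    then show "\<exists>N. \<forall>m\<ge>N. \<forall>n\<ge>N. norm (a m - a n) < d" by blast
  qed
  then obtain l where l: "a \<longlonglongrightarrow> l" using Cauchy_convergent convergent_def by blast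
  have "b = (\<lambda>n. f n - a n)" using fab by auto
  then have "b \<longlonglongrightarrow> z - l" using tendsto_diff[OF z l] by simp
  then have "z - l \<in> M2" by (rule closed_sequentially[OF M2(2) b])
  moreover have "l \<in> M1" by (rule closed_sequentially[OF M1(2) a(1) l])
  ultimately have "l + (z - l) \<in> M1 + M2" by (intro set_plus_intro)
  then show "z \<in> M1 + M2" by simp
qed

text \<open>By \<open>closed_sum\<close> no lower bound holds on \<open>G\<close>; normalising gives
  unit vectors almost fixed by \<open>T\<close> and, the defect norms being equal, by its adjoint
  too. Both kinds of slowness follow from the quadratic form.\<close>

lemma slow_vector:
  fixes r :: "nat \<Rightarrow> real"
  assumes ncl: "\<not> closed (M1 + M2)" and r: "r \<longlonglongrightarrow> 0"
  shows "\<exists>x. \<forall>n. r n \<le> inner ((T ^^ n) x - P x) x"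
proof -
  have "\<exists>x\<in>G. norm x = 1 \<and> norm (x - A.DR x) \<le> e \<and> norm (x - B.DR x) \<le> e" if e: "e > 0" for e
  proof (rule ccontr)
    assume "\<not> ?thesis"
    then have large: "norm (P1 x - P2 x) > e" if "x \<in> G" "norm x = 1" for x
      using that unfolding A.norm_DR_defect B.norm_DR_defect norm_minus_commute[of "P2 _"] by force
    have "e * norm x \<le> norm (P1 x - P2 x)" if x: "x \<in> G" for x
    proof (cases "x = 0")
      case False
      have "x /\<^sub>R norm x \<in> G"
        using x by (intro subspace_mul csubspace_imp_subspace[OF csubspace_ocomp])
      from large[OF this] have "e < norm ((P1 x - P2 x) /\<^sub>R norm x)" using False
        by (simp add: linear_scale[OF A.lin1] linear_scale[OF A.lin2] scaleR_diff_right)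
      also have "\<dots> = norm (P1 x - P2 x) / norm x" by (simp add: divide_inverse mult.commute)
      finally show ?thesis using False by (simp add: field_simps)
    qed simp
    then show False using closed_sum[OF e] ncl by blast
  qed
  from slow_orbit[OF csubspace_imp_subspace[OF csubspace_ocomp] closed_ocomp[OF csubspace_F] _ _ this r]
  obtain x where "x \<in> G" "\<forall>n. r n \<le> inner ((T ^^ n) x) x"
    using pow_G_tendsto_0 unfolding A_DR_eq by blast
  then show ?thesis by (intro exI[of _ x]) (simp add: P_eq_0)
qed

section \<open>The dense subspace of superpolynomially fast vectors\<close>

lemma T_pow_scaleC: "(T ^^ n) (c *\<^sub>C x) = c *\<^sub>C (T ^^ n) x"
  by (induction n)
    (simp_all add: douglas_rachford_def oproj_scaleC M1 M2 scaleC_add_right flip: scaleC_diff_right)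

lemma csubspace_superpolynomially_fast:
  "csubspace {x. superpolynomially_fast (\<lambda>n x. (T ^^ n) x - P x) x}"
  unfolding csubspace_def superpolynomially_fast_def mem_Collect_eq
proof (intro conjI allI ballI impI; (unfold mem_Collect_eq)?)
  show "(\<lambda>n. norm ((T ^^ n) 0 - P 0)) \<in> o(\<lambda>n. 1 / real n ^ k)" for k
    unfolding pow_minus_P by (simp add: linear_0[OF oproj_linear[OF csubspace_F closed_F]] linear_0[OF T_pow_linear])
next
  fix x y and k :: nat
  assume xy: "\<forall>k\<ge>1. (\<lambda>n. norm ((T ^^ n) x - P x)) \<in> o(\<lambda>n. 1 / real n ^ k)"
    "\<forall>k\<ge>1. (\<lambda>n. norm ((T ^^ n) y - P y)) \<in> o(\<lambda>n. 1 / real n ^ k)" and k: "1 \<le> k"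
  have "(\<lambda>n. norm ((T ^^ n) (x + y) - P (x + y))) \<in>
      O(\<lambda>n. norm ((T ^^ n) x - P x) + norm ((T ^^ n) y - P y))"
  proof (rule bigoI[of _ 1], intro always_eventually allI)
    fix n
    have "(T ^^ n) (x + y) - P (x + y) = ((T ^^ n) x - P x) + ((T ^^ n) y - P y)"
      by (simp add: linear_add[OF oproj_linear[OF csubspace_F closed_F]] linear_add[OF T_pow_linear])
    then show "norm (norm ((T ^^ n) (x + y) - P (x + y))) \<le>
        1 * norm (norm ((T ^^ n) x - P x) + norm ((T ^^ n) y - P y))"
      by (simp add: norm_triangle_ineq)
  qed
  also have "(\<lambda>n. norm ((T ^^ n) x - P x) + norm ((T ^^ n) y - P y)) \<in> o(\<lambda>n. 1 / real n ^ k)"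
    using xy k by (intro sum_in_smallo) auto
  finally show "(\<lambda>n. norm ((T ^^ n) (x + y) - P (x + y))) \<in> o(\<lambda>n. 1 / real n ^ k)" .
next
  fix c x and k :: nat
  assume x: "\<forall>k\<ge>1. (\<lambda>n. norm ((T ^^ n) x - P x)) \<in> o(\<lambda>n. 1 / real n ^ k)" and k: "1 \<le> k"
  have "norm ((T ^^ n) (c *\<^sub>C x) - P (c *\<^sub>C x)) = cmod c * norm ((T ^^ n) x - P x)" for n
    unfolding T_pow_scaleC oproj_scaleC[OF csubspace_F closed_F] scaleC_diff_right[symmetric] by (rule norm_scaleC)
  then show "(\<lambda>n. norm ((T ^^ n) (c *\<^sub>C x) - P (c *\<^sub>C x))) \<in> o(\<lambda>n. 1 / real n ^ k)"
    using x k by (cases "c = 0") auto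
qed

text \<open>The class \<open>2 * k + 2\<close> means decay like \<open>(n + 1)\<close> to the power
  \<open>-(k + 1)\<close>; after multiplication by \<open>n ^ k\<close> two factors of
  \<open>decay\<close> remain and tend to 0.\<close>

lemma decays_imp_superpolynomial:
  assumes "\<And>k. A.decays k y"
  shows "(\<lambda>n. norm ((T ^^ n) y)) \<in> o(\<lambda>n. 1 / real n ^ k)"
proof (rule smalloI_tendsto)
  obtain C where C: "C \<ge> 0" "\<And>n. norm ((A.DR ^^ n) y) \<le> C * decay n ^ (2 * k + 2)"
    using assms by (rule A.decaysE) blast
  have "(\<lambda>n. C * decay n * decay n) \<longlonglongrightarrow> C * 0 * 0" by (intro tendsto_intros decay_tendsto_0)
  then have lim: "(\<lambda>n. C * decay n * decay n) \<longlonglongrightarrow> 0" by simp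
  have sq: "decay n * decay n = 1 / (real n + 1)" for n by (simp add: decay_def)
  show "(\<lambda>n. norm ((T ^^ n) y) / (1 / real n ^ k)) \<longlonglongrightarrow> 0"
  proof (rule Lim_null_comparison[OF _ lim], intro always_eventually allI)
    fix n
    have eq: "decay n ^ (2 * k + 2) = (1 / (real n + 1)) ^ k * (decay n * decay n)"
      by (simp only: power_add power_mult power2_eq_square sq)
    have "norm ((T ^^ n) y) * real n ^ k \<le> (C * decay n * decay n) * ((1 / (real n + 1)) ^ k * real n ^ k)"
      using mult_right_mono[OF C(2)[of n], of "real n ^ k"] unfolding eq A_DR_eq by (simp add: mult_ac)
    also have "(1 / (real n + 1)) ^ k * real n ^ k = (real n / (real n + 1)) ^ k"
      by (simp add: power_divide)
    also have "(C * decay n * decay n) * (real n / (real n + 1)) ^ k \<le> (C * decay n * decay n) * 1"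
      using C(1) decay_pos[of n] by (intro mult_left_mono power_le_one) auto
    finally show "norm (norm ((T ^^ n) y) / (1 / real n ^ k)) \<le> C * decay n * decay n" by simp
  qed
  \<comment> \<open>At \<open>n = 0\<close> and \<open>k > 0\<close> the comparison function is 0,
    since division by zero gives 0.\<close>
  show "eventually (\<lambda>n. 1 / real n ^ k \<noteq> 0) sequentially"
    using eventually_gt_at_top[of 0] by eventually_elim simp
qed

text \<open>The fixed component \<open>P x\<close> is kept, and only \<open>x - P x\<close> is
  replaced by a rapidly decaying vector.\<close>

lemma superpolynomially_fast_dense:
  "closure {x. superpolynomially_fast (\<lambda>n x. (T ^^ n) x - P x) x} = UNIV"
proof (rule set_eqI, rule iffI[OF UNIV_I])
  fix x :: 'a
  show "x \<in> closure {x. superpolynomially_fast (\<lambda>n x. (T ^^ n) x - P x) x}"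
    unfolding closure_approachable
  proof (intro allI impI)
    fix e :: real assume e: "e > 0"
    obtain y where y: "norm (y - (x - P x)) \<le> e / 2" "\<And>k. A.decays k y"
      using A.rapidly_decaying_dense[of "x - P x" "e/2"] pow_G_tendsto_0[OF complement_in_G, of x] e
      by (auto simp: A_DR_eq)
    obtain C where C: "C \<ge> 0" "\<And>n. norm ((A.DR ^^ n) y) \<le> C * decay n ^ 1"
      using y(2) by (rule A.decaysE) blast
    have "(\<lambda>n. (T ^^ n) y) \<longlonglongrightarrow> 0"
      by (rule Lim_null_comparison[of _ "\<lambda>n. C * decay n"])
        (use C in \<open>auto intro!: tendsto_mult_right_zero decay_tendsto_0 simp: A_DR_eq\<close>)
    \<comment> \<open>Membership of \<open>y\<close> in \<open>G\<close> has not been recorded;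
      instead its orbit tends both to 0 and to \<open>P y\<close>.\<close>
    from tendsto_diff[OF this strong_convergence[of y]] have "P y = 0"
      by (simp add: LIMSEQ_const_iff)
    note Fcl = csubspace_F closed_F
    define w where "w = P x + y"
    have "P w = P x" using \<open>P y = 0\<close> by (simp add: w_def linear_add[OF oproj_linear[OF Fcl]] oproj_id[OF Fcl oproj_mem[OF Fcl]])
    then have "(T ^^ n) w - P w = (T ^^ n) y" for n
      by (simp add: w_def linear_add[OF T_pow_linear] pow_fixed[OF oproj_mem[OF Fcl]])
    then have "superpolynomially_fast (\<lambda>n x. (T ^^ n) x - P x) w"
      using decays_imp_superpolynomial[OF y(2)] by (simp add: superpolynomially_fast_def)
    moreover have "dist w x < e" using y(1) e by (simp add: w_def dist_norm algebra_simps)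
    ultimately show "\<exists>w\<in>{x. superpolynomially_fast (\<lambda>n x. (T ^^ n) x - P x) x}. dist w x < e" by blast
  qed
qed

end

theorem theorem5p2:
  fixes M1 M2 :: "'a::complex_hilbert set" and T P :: "'a \<Rightarrow> 'a"
  assumes "csubspace M1" and "closed M1"
    and "csubspace M2" and "closed M2"
    and T_def: "T = douglas_rachford M1 M2"
    and P_def: "P = oproj ((M1 \<inter> M2) + (ocomp M1 \<inter> ocomp M2))"
  shows "(\<forall>x. (\<lambda>n. norm ((T ^^ n) x - P x)) \<longlonglongrightarrow> 0) \<and>
    (closed (M1 + M2) \<longrightarrow>
       (\<exists>C>0. \<exists>r\<in>{0..<1}. \<forall>n. onorm (\<lambda>x. (T ^^ n) x - P x) \<le> C * r ^ n)) \<and>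
    (\<not> closed (M1 + M2) \<longrightarrow>
       arbitrarily_slow (\<lambda>n x. (T ^^ n) x - P x) \<and>
       weakly_arbitrarily_slow (\<lambda>n x. (T ^^ n) x - P x)) \<and>
    (\<exists>X0. csubspace X0 \<and> closure X0 = UNIV \<and>
       (\<forall>x\<in>X0. superpolynomially_fast (\<lambda>n x. (T ^^ n) x - P x) x))"
proof -
  interpret D: closed_subspace_pair M1 M2 using assms by unfold_locales
  have TP: "T = douglas_rachford M1 M2" "P = oproj D.F" by (simp_all add: T_def P_def D.F_def)
  show ?thesis unfolding TP
  proof (intro conjI impI allI)
    show "(\<lambda>n. norm ((douglas_rachford M1 M2 ^^ n) x - oproj D.F x)) \<longlonglongrightarrow> 0" for x
      by (rule tendsto_norm_zero[OF D.strong_convergence])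
    show "\<exists>C>0. \<exists>r\<in>{0..<1}. \<forall>n. onorm (\<lambda>x. (douglas_rachford M1 M2 ^^ n) x - oproj D.F x) \<le> C * r ^ n"
      if "closed (M1 + M2)"
      using D.exponential_convergence[OF that] by (intro exI[of _ 1]) simp
    show "\<exists>X0. csubspace X0 \<and> closure X0 = UNIV \<and>
       (\<forall>x\<in>X0. superpolynomially_fast (\<lambda>n x. (douglas_rachford M1 M2 ^^ n) x - oproj D.F x) x)"
      using D.csubspace_superpolynomially_fast D.superpolynomially_fast_dense by blast
    assume ncl: "\<not> closed (M1 + M2)"
    show "weakly_arbitrarily_slow (\<lambda>n x. (douglas_rachford M1 M2 ^^ n) x - oproj D.F x)"
      unfolding weakly_arbitrarily_slow_def
      using D.slow_vector[OF ncl] cinner_left_in_cdual by (metis inner_eq_Re_cinner)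
    show "arbitrarily_slow (\<lambda>n x. (douglas_rachford M1 M2 ^^ n) x - oproj D.F x)"
      unfolding arbitrarily_slow_def
    proof (intro allI impI)
      fix r :: "nat \<Rightarrow> real" assume r: "(\<forall>n. 0 \<le> r n) \<and> r \<longlonglongrightarrow> 0"
      obtain x where x: "\<And>n. r n \<le> inner ((D.T ^^ n) x - D.P x) x"
        using D.slow_vector[OF ncl] r by blast
      \<comment> \<open>Cauchy-Schwarz leaves a factor \<open>norm x\<close>, which is absorbed into
        the vector.\<close>
      have "r n \<le> norm ((D.T ^^ n) (norm x *\<^sub>R x) - D.P (norm x *\<^sub>R x))" for n
      proof -
        have "r n \<le> norm ((D.T ^^ n) x - D.P x) * norm x"
          using x[of n] norm_cauchy_schwarz order_trans by blast
        also have "\<dots> = norm (norm x *\<^sub>R ((D.T ^^ n) x - D.P x))" by (simp add: mult.commute)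
        finally show ?thesis
          by (simp add: linear_scale[OF D.T_pow_linear] scaleR_diff_right
              linear_scale[OF oproj_linear[OF D.csubspace_F D.closed_F]])
      qed
      then show "\<exists>x. \<forall>n. r n \<le> norm ((D.T ^^ n) x - D.P x)" by blast
    qed
  qed
qed

end
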